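(* There exists a Fraïssé class $\mathcal{Z}$ of finite models in a finite signature (function symbols allowed) such that the class $\{\operatorname{Aut}(M) : M \in \mathcal{Z}\}$ consists of abelian groups and contains, up to isomorphism, all finite products of finite cyclic groups, while the automorphism group of the Fraïssé limit of $\mathcal{Z}$ is torsion-free.
   Context: A class of finitely generated models of a first-order language is a Fraïssé class if it is hereditary (closed under finitely generated substructures), has the joint embedding property, has countably many isomorphism types, and has the amalgamation property. The Fraïssé limit of $\mathcal{Z}$ is the unique (up to isomorphism) countable homogeneous structure whose age (the class of all finitely generated structures embeddable into it) is $\mathcal{Z}$. A group is torsion-free if it has no non-identity element of finite order. *)

theory Defs
  imports "HOL-Algebra.Bij" "HOL-Algebra.Product_Groups" "HOL-Library.Countable_Set"
begin

section \<open>First-order structures\<close>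

text \<open>
  The symbols of a signature are named by natural numbers. The arities of numbers that are not in
  the respective set of symbols are irrelevant; function symbols of arity 0 are constants.
\<close>

record signature =
  fun_syms :: "nat set"
  fun_arity :: "nat \<Rightarrow> nat"
  rel_syms :: "nat set"
  rel_arity :: "nat \<Rightarrow> nat"

definition finite_signature :: "signature \<Rightarrow> bool" where
  "finite_signature L \<longleftrightarrow> finite (fun_syms L) \<and> finite (rel_syms L)"

text \<open>
  The interpretations are total on lists. Only their values at the symbols of the signature, and
  there only on lists of the right length over the universe, are ever taken into account.
\<close>

record 'a model =
  univ :: "'a set"
  fun_int :: "nat \<Rightarrow> 'a list \<Rightarrow> 'a"
  rel_int :: "nat \<Rightarrow> 'a list \<Rightarrow> bool"

definition tuples :: "'a model \<Rightarrow> nat \<Rightarrow> 'a list set" where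
  "tuples A n = {xs. length xs = n \<and> set xs \<subseteq> univ A}"

text \<open>As usual in first-order logic, models are nonempty.\<close>

definition is_model :: "signature \<Rightarrow> 'a model \<Rightarrow> bool" where
  "is_model L A \<longleftrightarrow> univ A \<noteq> {} \<and>
     (\<forall>f\<in>fun_syms L. \<forall>xs\<in>tuples A (fun_arity L f). fun_int A f xs \<in> univ A)"

definition embedding :: "signature \<Rightarrow> 'a model \<Rightarrow> 'b model \<Rightarrow> ('a \<Rightarrow> 'b) \<Rightarrow> bool" where
  "embedding L A B h \<longleftrightarrow> h ` univ A \<subseteq> univ B \<and> inj_on h (univ A) \<and>
     (\<forall>f\<in>fun_syms L. \<forall>xs\<in>tuples A (fun_arity L f).
        h (fun_int A f xs) = fun_int B f (map h xs)) \<and>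
     (\<forall>r\<in>rel_syms L. \<forall>xs\<in>tuples A (rel_arity L r).
        rel_int A r xs \<longleftrightarrow> rel_int B r (map h xs))"

definition isomorphism :: "signature \<Rightarrow> 'a model \<Rightarrow> 'b model \<Rightarrow> ('a \<Rightarrow> 'b) \<Rightarrow> bool" where
  "isomorphism L A B h \<longleftrightarrow> embedding L A B h \<and> h ` univ A = univ B"

definition embeddable :: "signature \<Rightarrow> 'a model \<Rightarrow> 'b model \<Rightarrow> bool" where
  "embeddable L A B \<longleftrightarrow> (\<exists>h. embedding L A B h)"

definition isomorphic :: "signature \<Rightarrow> 'a model \<Rightarrow> 'b model \<Rightarrow> bool" where
  "isomorphic L A B \<longleftrightarrow> (\<exists>h. isomorphism L A B h)"

definition substructure :: "signature \<Rightarrow> 'a model \<Rightarrow> 'a model \<Rightarrow> bool" where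
  "substructure L A B \<longleftrightarrow> is_model L A \<and> univ A \<subseteq> univ B \<and>
     (\<forall>f\<in>fun_syms L. \<forall>xs\<in>tuples A (fun_arity L f). fun_int A f xs = fun_int B f xs) \<and>
     (\<forall>r\<in>rel_syms L. \<forall>xs\<in>tuples A (rel_arity L r). rel_int A r xs \<longleftrightarrow> rel_int B r xs)"

inductive_set generated :: "signature \<Rightarrow> 'a model \<Rightarrow> 'a set \<Rightarrow> 'a set"
  for L :: signature and A :: "'a model" and X :: "'a set" where
  base: "x \<in> X \<Longrightarrow> x \<in> generated L A X"
| step: "f \<in> fun_syms L \<Longrightarrow> length xs = fun_arity L f \<Longrightarrow> \<forall>x\<in>set xs. x \<in> generated L A X
    \<Longrightarrow> fun_int A f xs \<in> generated L A X"

definition finitely_generated :: "signature \<Rightarrow> 'a model \<Rightarrow> bool" where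
  "finitely_generated L A \<longleftrightarrow> (\<exists>X. finite X \<and> X \<subseteq> univ A \<and> generated L A X = univ A)"


section \<open>Automorphism groups\<close>

text \<open>As for \<^const>\<open>AutoGroup\<close>, automorphisms are extensional functions.\<close>

definition automorphisms :: "signature \<Rightarrow> 'a model \<Rightarrow> ('a \<Rightarrow> 'a) set" where
  "automorphisms L A = {g \<in> Bij (univ A). isomorphism L A A g}"

definition Aut :: "signature \<Rightarrow> 'a model \<Rightarrow> ('a \<Rightarrow> 'a) monoid" where
  "Aut L A = BijGroup (univ A) \<lparr>carrier := automorphisms L A\<rparr>"

definition torsion_free :: "('a, 'b) monoid_scheme \<Rightarrow> bool" where
  "torsion_free G \<longleftrightarrow>
     (\<forall>x\<in>carrier G. (\<exists>n::nat. n > 0 \<and> x [^]\<^bsub>G\<^esub> n = \<one>\<^bsub>G\<^esub>) \<longrightarrow> x = \<one>\<^bsub>G\<^esub>)"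


section \<open>Fraisse classes and Fraisse limits\<close>

text \<open>
  A class of models is a set of models whose universes are subsets of a fixed type and which is
  closed under isomorphism within that type.
\<close>

definition iso_closed :: "signature \<Rightarrow> 'a model set \<Rightarrow> bool" where
  "iso_closed L Z \<longleftrightarrow>
     (\<forall>A\<in>Z. \<forall>B :: 'a model. is_model L B \<and> isomorphic L A B \<longrightarrow> B \<in> Z)"

definition hereditary :: "signature \<Rightarrow> 'a model set \<Rightarrow> bool" where
  "hereditary L Z \<longleftrightarrow>
     (\<forall>B\<in>Z. \<forall>A. substructure L A B \<and> finitely_generated L A \<longrightarrow> A \<in> Z)"

definition joint_embedding :: "signature \<Rightarrow> 'a model set \<Rightarrow> bool" where
  "joint_embedding L Z \<longleftrightarrow>
     (\<forall>A\<in>Z. \<forall>B\<in>Z. \<exists>C\<in>Z. embeddable L A C \<and> embeddable L B C)"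

definition amalgamation :: "signature \<Rightarrow> 'a model set \<Rightarrow> bool" where
  "amalgamation L Z \<longleftrightarrow>
     (\<forall>A\<in>Z. \<forall>B\<in>Z. \<forall>C\<in>Z. \<forall>f g. embedding L A B f \<and> embedding L A C g \<longrightarrow>
        (\<exists>D\<in>Z. \<exists>f' g'. embedding L B D f' \<and> embedding L C D g' \<and>
           (\<forall>x\<in>univ A. f' (f x) = g' (g x))))"

definition countably_many_iso_types :: "signature \<Rightarrow> 'a model set \<Rightarrow> bool" where
  "countably_many_iso_types L Z \<longleftrightarrow>
     (\<exists>R. countable R \<and> R \<subseteq> Z \<and> (\<forall>A\<in>Z. \<exists>B\<in>R. isomorphic L A B))"

definition fraisse_class :: "signature \<Rightarrow> 'a model set \<Rightarrow> bool" where
  "fraisse_class L Z \<longleftrightarrow>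
     (\<forall>A\<in>Z. is_model L A \<and> finitely_generated L A) \<and>
     iso_closed L Z \<and> hereditary L Z \<and> joint_embedding L Z \<and>
     countably_many_iso_types L Z \<and> amalgamation L Z"

definition homogeneous :: "signature \<Rightarrow> 'a model \<Rightarrow> bool" where
  "homogeneous L M \<longleftrightarrow>
     (\<forall>A B h. substructure L A M \<and> finitely_generated L A \<and>
        substructure L B M \<and> finitely_generated L B \<and> isomorphism L A B h \<longrightarrow>
        (\<exists>g\<in>automorphisms L M. \<forall>x\<in>univ A. g x = h x))"

text \<open>
  Countable models, and in particular all members of the age of a countable model, have isomorphic
  copies with universe contained in \<^typ>\<open>nat\<close>.
\<close>

definition age :: "signature \<Rightarrow> 'a model \<Rightarrow> nat model set" where
  "age L M = {A. is_model L A \<and> finitely_generated L A \<and> embeddable L A M}"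

definition fraisse_limit :: "signature \<Rightarrow> nat model set \<Rightarrow> 'a model \<Rightarrow> bool" where
  "fraisse_limit L Z M \<longleftrightarrow>
     is_model L M \<and> countable (univ M) \<and> homogeneous L M \<and> age L M = Z"

end

theory Submission
  imports Defs "HOL-Algebra.Multiplicative_Group"
begin

text \<open>
  Take finite models consisting of a permutation \<open>s\<close>, a function \<open>p\<close> commuting with \<open>s\<close>, and a total
  preorder whose classes are exactly the \<open>s\<close>-orbits. Automorphisms of such a model preserve every
  orbit and act on it as a power of \<open>s\<close>, hence they commute; with \<open>p\<close> the identity every product of
  finite cyclic groups occurs. Amalgamation is free on \<open>s\<close> and \<open>p\<close> and a shuffling of linear orders
  on the orbits. In the limit, an automorphism \<open>g\<close> with \<open>g^k = 1\<close> also preserves every orbit, since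
  it respects the preorder. A point \<open>x\<close> on an orbit of length \<open>n\<close> is of the form \<open>p c\<close> with \<open>c\<close> on an
  orbit of length \<open>k n\<close>. If \<open>g\<close> rotates the latter orbit by \<open>r\<close>, then \<open>k n\<close> divides \<open>k r\<close>, so
  \<open>n\<close> divides \<open>r\<close> and \<open>g x = x\<close>: on a tower of covers \<open>g\<close> acts as an element of the torsion-free
  group of profinite integers.
\<close>

subsection \<open>Embeddings and substructures\<close>

text \<open>The obstacle is homogeneity: every automorphism of a finite substructure extends to the
  limit, so a rotation of finite order must be forced to have only extensions of infinite order.
  This is the purpose of \<open>p\<close>. With \<open>s\<close> and the preorder alone, rotating
  one orbit and fixing all other points would be a torsion automorphism of the limit. With
  \<open>p\<close>, a rotation of an orbit determines the rotation of the image orbit, while an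
  automorphism that is trivial on an orbit of length \<open>n\<close> may still rotate the covers of
  that orbit by multiples of \<open>n\<close>. The preorder serves commutativity: without it,
  isomorphic orbits could be interchanged. It must not separate points of one orbit, since otherwise
  no rotation would survive. Orbits of the limit are preserved only by maps under which points
  return: in a linear order a point that moves strictly up under an automorphism keeps moving up.
  The general part on Fraisse limits is restricted to classes of finite models, so that finitely
  generated submodels can be replaced by finite subsets of one ambient model.\<close>

lemma tuples_univ_update [simp]: "tuples (A\<lparr>univ := S\<rparr>) n = {xs. length xs = n \<and> set xs \<subseteq> S}"
  by (simp add: tuples_def)

lemma map_in_tuples: "h ` univ A \<subseteq> univ B \<Longrightarrow> xs \<in> tuples A n \<Longrightarrow> map h xs \<in> tuples B n"
  by (auto simp: tuples_def)

lemma embedding_comp: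
  assumes "embedding L A B f" "embedding L B C g"
  shows "embedding L A C (g \<circ> f)"
proof -
  have "map f xs \<in> tuples B n" if "xs \<in> tuples A n" for xs n
    using assms(1) that by (auto intro: map_in_tuples simp: embedding_def)
  moreover have "inj_on (g \<circ> f) (univ A)"
    using assms by (auto simp: embedding_def intro!: comp_inj_on intro: inj_on_subset)
  ultimately show ?thesis
    using assms by (fastforce simp: embedding_def)
qed

text \<open>That \<open>A\<close> is a model keeps the values \<open>fun_int A f xs\<close> inside
  the universe, the only place where \<open>f\<close> and \<open>g\<close> are known to agree. The
  lemma turns composites into \<open>id\<close> and maps into their extensional
  restrictions.\<close>

lemma embedding_cong:
  assumes "embedding L A B f" "is_model L A" "\<And>x. x \<in> univ A \<Longrightarrow> f x = g x"
  shows "embedding L A B g"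
proof -
  have "map g xs = map f xs" if "xs \<in> tuples A n" for xs n
    using that assms(3) by (auto simp: tuples_def)
  moreover have "g ` univ A = f ` univ A"
    using assms(3) by simp
  moreover have "inj_on g (univ A) = inj_on f (univ A)"
    by (intro inj_on_cong) (simp add: assms(3))
  ultimately show ?thesis
    using assms by (simp add: embedding_def is_model_def del: map_eq_conv)
qed

lemma embedding_into_substructure:
  assumes "embedding L A M h" "substructure L N M" "h ` univ A \<subseteq> univ N"
  shows "embedding L A N h"
proof -
  have "map h xs \<in> tuples N n" if "xs \<in> tuples A n" for xs n
    using that assms(3) by (rule map_in_tuples[rotated])
  then show ?thesis
    using assms by (auto simp: embedding_def substructure_def)
qed

lemma embedding_subset:
  assumes "embedding L A B h" "S \<subseteq> univ A"
  shows "embedding L (A\<lparr>univ := S\<rparr>) B h"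
proof -
  have "xs \<in> tuples A n" if "set xs \<subseteq> S" "length xs = n" for xs n
    using that assms(2) by (auto simp: tuples_def)
  moreover have "inj_on h S" "h ` S \<subseteq> univ B"
    using assms by (auto simp: embedding_def intro: inj_on_subset)
  ultimately show ?thesis
    using assms(1) by (simp add: embedding_def)
qed

text \<open>Facts about substructures thereby become instances of composing embeddings.\<close>

lemma substructure_iff_embedding: "substructure L A B \<longleftrightarrow> is_model L A \<and> embedding L A B id"
  by (auto simp: substructure_def embedding_def)

lemma substructure_trans: "substructure L A B \<Longrightarrow> substructure L B C \<Longrightarrow> substructure L A C"
  using embedding_comp[of L A B id C id] by (simp add: substructure_iff_embedding)

lemma substructure_univ_update:
  "S \<subseteq> univ A \<Longrightarrow> substructure L (A\<lparr>univ := S\<rparr>) A \<longleftrightarrow> is_model L (A\<lparr>univ := S\<rparr>)"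
  by (auto simp: substructure_def)

text \<open>Interpretations are total, so a substructure may differ as a record from the restriction
  of \<open>M\<close> to the same universe. The two are isomorphic by \<open>id\<close>, which
  allows working with restrictions only.\<close>

lemma substructure_eq_univ_update:
  assumes "substructure L A M"
  shows "is_model L (M\<lparr>univ := univ A\<rparr>)" "isomorphism L (M\<lparr>univ := univ A\<rparr>) A id"
  using assms by (auto simp: substructure_def is_model_def isomorphism_def embedding_def tuples_def)

lemma is_model_image:
  assumes "embedding L A B h" "is_model L A"
  shows "is_model L (B\<lparr>univ := h ` univ A\<rparr>)"
proof -
  have "fun_int B f ys \<in> h ` univ A"
    if f: "f \<in> fun_syms L" and ys: "length ys = fun_arity L f" "set ys \<subseteq> h ` univ A" for f ys
  proof -
    define xs where "xs = map (inv_into (univ A) h) ys"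
    have "xs \<in> tuples A (fun_arity L f)"
      using ys by (auto simp: xs_def tuples_def inv_into_into)
    moreover have "map h xs = ys"
      using ys by (auto simp: xs_def f_inv_into_f intro!: map_idI)
    ultimately show ?thesis
      using assms f by (metis embedding_def image_eqI is_model_def)
  qed
  then show ?thesis
    using assms(2) by (auto simp: is_model_def)
qed

lemma isomorphism_onto_image:
  "embedding L A B h \<Longrightarrow> isomorphism L A (B\<lparr>univ := h ` univ A\<rparr>) h"
  by (simp add: isomorphism_def embedding_def)

lemma isomorphism_inv_into:
  assumes "isomorphism L A B h" "is_model L A"
  shows "isomorphism L B A (inv_into (univ A) h)"
proof -
  have img: "h ` univ A = univ B" and inj: "inj_on h (univ A)" and h: "embedding L A B h"
    using assms by (auto simp: isomorphism_def embedding_def)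
  let ?k = "inv_into (univ A) h"
  have xs: "map ?k ys \<in> tuples A n" "map h (map ?k ys) = ys" if "ys \<in> tuples B n" for ys n
    using that img by (auto simp: tuples_def inv_into_into f_inv_into_f intro!: map_idI)
  have "?k (fun_int B f ys) = fun_int A f (map ?k ys)"
    if f: "f \<in> fun_syms L" and ys: "ys \<in> tuples B (fun_arity L f)" for f ys
  proof -
    have "h (fun_int A f (map ?k ys)) = fun_int B f ys"
      using h f xs[OF ys] by (metis embedding_def)
    moreover have "fun_int A f (map ?k ys) \<in> univ A"
      using assms(2) f xs[OF ys] by (auto simp: is_model_def)
    ultimately show ?thesis
      by (metis inj inv_into_f_f)
  qed
  moreover have "rel_int B r ys \<longleftrightarrow> rel_int A r (map ?k ys)"
    if r: "r \<in> rel_syms L" and ys: "ys \<in> tuples B (rel_arity L r)" for r ys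
    using h r xs[OF ys] by (metis embedding_def)
  moreover have "?k ` univ B = univ A"
    using img inj by (metis inv_into_image_cancel order_refl)
  moreover have "inj_on ?k (univ B)"
    using img by (metis inj_on_inv_into order_refl)
  ultimately show ?thesis
    by (simp add: isomorphism_def embedding_def)
qed

lemma embedding_inv_into:
  assumes "embedding L A B h" "is_model L A"
  shows "embedding L (B\<lparr>univ := h ` univ A\<rparr>) A (inv_into (univ A) h)"
  using isomorphism_inv_into[OF isomorphism_onto_image] assms by (auto simp: isomorphism_def)

section \<open>Generated submodels and finiteness\<close>

lemma generated_subset:
  assumes "is_model L A" "X \<subseteq> univ A"
  shows "generated L A X \<subseteq> univ A"
proof
  fix x assume "x \<in> generated L A X"
  then show "x \<in> univ A"
  proof induction
    case (step f xs)
    then show ?case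
      using assms(1) by (auto simp: is_model_def tuples_def)
  qed (use assms in auto)
qed

lemma finitely_generated_finite:
  assumes "finite (univ A)" "is_model L A"
  shows "finitely_generated L A"
  using assms generated_subset[OF assms(2) order_refl] generated.base[of _ "univ A" L A]
  by (auto simp: finitely_generated_def)

lemma generated_univ_update: "generated L (A\<lparr>univ := S\<rparr>) X = generated L A X"
proof -
  have "x \<in> generated L A X" if "x \<in> generated L (A\<lparr>univ := S\<rparr>) X" for x
    using that by induction (auto intro: generated.base generated.step)
  moreover have "x \<in> generated L (A\<lparr>univ := S\<rparr>) X" if "x \<in> generated L A X" for x
    using that
  proof induction
    case (step f xs)
    then show ?case
      using generated.step[of f L xs "A\<lparr>univ := S\<rparr>" X] by auto
  qed (auto intro: generated.base)
  ultimately show ?thesis by blast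
qed

lemma generated_substructure:
  assumes "is_model L A" "finite X" "X \<noteq> {}" "X \<subseteq> univ A"
  shows "substructure L (A\<lparr>univ := generated L A X\<rparr>) A"
    and "finitely_generated L (A\<lparr>univ := generated L A X\<rparr>)"
proof -
  have "is_model L (A\<lparr>univ := generated L A X\<rparr>)"
    using assms(3) generated.step[of _ L _ A X] by (auto simp: is_model_def intro: generated.base)
  then show "substructure L (A\<lparr>univ := generated L A X\<rparr>) A"
    using generated_subset[OF assms(1,4)] by (simp add: substructure_univ_update)
  show "finitely_generated L (A\<lparr>univ := generated L A X\<rparr>)"
    using assms(2) by (auto simp: finitely_generated_def generated_univ_update
        intro!: exI[of _ X] generated.base)
qed

text \<open>Transport of structure. It serves to rename points so that a given embedding becomes an
  inclusion.\<close>

definition map_model :: "('a \<Rightarrow> 'b) \<Rightarrow> 'a model \<Rightarrow> 'b model" where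
  "map_model h A = \<lparr>univ = h ` univ A,
     fun_int = \<lambda>f ys. h (fun_int A f (map (inv_into (univ A) h) ys)),
     rel_int = \<lambda>r ys. rel_int A r (map (inv_into (univ A) h) ys)\<rparr>"

lemma isomorphism_map_model:
  assumes "inj_on h (univ A)"
  shows "isomorphism L A (map_model h A) h"
proof -
  have "map (inv_into (univ A) h) (map h xs) = xs" if "xs \<in> tuples A n" for xs n
    using that assms by (auto simp: tuples_def intro!: map_idI)
  then show ?thesis
    using assms by (auto simp: isomorphism_def embedding_def map_model_def)
qed

lemma is_model_map_model:
  assumes "inj_on h (univ A)" "is_model L A"
  shows "is_model L (map_model h A)"
  using is_model_image[OF _ assms(2), of "map_model h A" h] isomorphism_map_model[OF assms(1), of L]
  by (simp add: isomorphism_def map_model_def)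

text \<open>All universes consist of numbers, so there is always room: points outside
  \<open>S\<close> are translated past a bound for \<open>X\<close> and for the prescribed
  values.\<close>

lemma inj_extension_avoiding:
  fixes \<phi> :: "nat \<Rightarrow> nat"
  assumes "inj_on \<phi> S" "finite S" "finite X"
  obtains \<sigma> where "inj \<sigma>" "\<And>x. x \<in> S \<Longrightarrow> \<sigma> x = \<phi> x" "\<And>x. x \<notin> S \<Longrightarrow> \<sigma> x \<notin> X"
proof -
  obtain m where m: "X \<union> \<phi> ` S \<subseteq> {..<m}"
    using assms finite_nat_iff_bounded[of "X \<union> \<phi> ` S"] by auto
  define \<sigma> where "\<sigma> x = (if x \<in> S then \<phi> x else x + m)" for x
  have less: "\<phi> x < m" if "x \<in> S" for x
    using m that by auto
  have "\<sigma> x \<noteq> \<sigma> y" if "x \<noteq> y" for x y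
    using that inj_onD[OF assms(1), of x y] less[of x] less[of y] by (auto simp: \<sigma>_def)
  then have "inj \<sigma>"
    by (auto simp: inj_def)
  then show thesis
    by (rule that) (use m in \<open>auto simp: \<sigma>_def\<close>)
qed

subsection \<open>Back and forth\<close>

text \<open>The richness condition of Fraisse theory. The smaller model is a restriction of
  \<open>B\<close>, so an extension problem is given by \<open>B\<close>, a subset and a
  map.\<close>

definition extension_property :: "signature \<Rightarrow> 'a model set \<Rightarrow> 'b model \<Rightarrow> bool" where
  "extension_property L Z M \<longleftrightarrow>
     (\<forall>B\<in>Z. \<forall>S\<subseteq>univ B. \<forall>h. is_model L (B\<lparr>univ := S\<rparr>) \<and> embedding L (B\<lparr>univ := S\<rparr>) M h \<longrightarrow>
        (\<exists>g. embedding L B M g \<and> (\<forall>x\<in>S. g x = h x)))"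

lemma extension_propertyD:
  assumes "extension_property L Z M" "B \<in> Z" "S \<subseteq> univ B" "is_model L (B\<lparr>univ := S\<rparr>)"
    "embedding L (B\<lparr>univ := S\<rparr>) M h"
  obtains g where "embedding L B M g" "\<And>x. x \<in> S \<Longrightarrow> g x = h x"
  using assms unfolding extension_property_def by metis

text \<open>Transporting an extension problem along an isomorphism leaves only the representatives
  of the isomorphism types to be treated, hence countably many problems.\<close>

lemma extension_property_iso_types:
  assumes ext: "extension_property L R M" and Z: "\<And>B. B \<in> Z \<Longrightarrow> is_model L B"
    and R: "\<forall>A\<in>Z. \<exists>B\<in>R. isomorphic L A B"
  shows "extension_property L Z M"
  unfolding extension_property_def
proof (intro ballI allI impI)
  fix B S h
  assume B: "B \<in> Z" and S: "S \<subseteq> univ B"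
    and *: "is_model L (B\<lparr>univ := S\<rparr>) \<and> embedding L (B\<lparr>univ := S\<rparr>) M h"
  obtain B' k where B': "B' \<in> R" and k: "isomorphism L B B' k"
    using R B by (auto simp: isomorphic_def)
  have emb: "embedding L (B\<lparr>univ := S\<rparr>) B' k"
    using k S by (auto simp: isomorphism_def intro: embedding_subset)
  let ?k = "inv_into S k"
  have inj: "inj_on k S"
    using emb by (simp add: embedding_def)
  have S': "k ` S \<subseteq> univ B'"
    using emb by (simp add: embedding_def)
  moreover have m: "is_model L (B'\<lparr>univ := k ` S\<rparr>)"
    using is_model_image[OF emb] * by simp
  moreover have "embedding L (B'\<lparr>univ := k ` S\<rparr>) M (h \<circ> ?k)"
    using embedding_comp[OF embedding_inv_into[OF emb], of M h] * by simp
  ultimately obtain g where g: "embedding L B' M g" "\<And>y. y \<in> k ` S \<Longrightarrow> g y = (h \<circ> ?k) y"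
    using extension_propertyD[OF ext B'] by blast
  have "embedding L B M (g \<circ> k)"
    using k g(1) by (auto simp: isomorphism_def intro: embedding_comp)
  moreover have "\<forall>x\<in>S. (g \<circ> k) x = h x"
    using g(2) inj by simp
  ultimately show "\<exists>g. embedding L B M g \<and> (\<forall>x\<in>S. g x = h x)"
    by blast
qed

definition locally_in :: "signature \<Rightarrow> 'a model set \<Rightarrow> 'a model \<Rightarrow> bool" where
  "locally_in L Z M \<longleftrightarrow>
     (\<forall>X. finite X \<and> X \<subseteq> univ M \<longrightarrow> (\<exists>T. finite T \<and> X \<subseteq> T \<and> T \<subseteq> univ M \<and> M\<lparr>univ := T\<rparr> \<in> Z))"

lemma locally_inD:
  assumes "locally_in L Z M" "finite X" "X \<subseteq> univ M"
  obtains T where "finite T" "X \<subseteq> T" "T \<subseteq> univ M" "M\<lparr>univ := T\<rparr> \<in> Z"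
  using assms unfolding locally_in_def by metis

text \<open>The domain has to be a model but not a member of the class; this makes the notion stable
  under inverses without any closure property of the class.\<close>

definition partial_aut :: "signature \<Rightarrow> 'a model \<Rightarrow> 'a set \<times> ('a \<Rightarrow> 'a) \<Rightarrow> bool" where
  "partial_aut L M = (\<lambda>(T, h). finite T \<and> T \<subseteq> univ M \<and> is_model L (M\<lparr>univ := T\<rparr>) \<and>
     embedding L (M\<lparr>univ := T\<rparr>) M h)"

lemma partial_aut_inverse:
  assumes "partial_aut L M (T, h)"
  shows "partial_aut L M (h ` T, inv_into T h)"
proof -
  have *: "finite T" "T \<subseteq> univ M" "is_model L (M\<lparr>univ := T\<rparr>)" "embedding L (M\<lparr>univ := T\<rparr>) M h"
    using assms by (auto simp: partial_aut_def)
  have "embedding L (M\<lparr>univ := h ` T\<rparr>) (M\<lparr>univ := T\<rparr>) (inv_into T h)"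
    using embedding_inv_into[OF *(4,3)] by simp
  moreover have "embedding L (M\<lparr>univ := T\<rparr>) M id"
    using *(2,3) substructure_univ_update[of T M L] by (simp add: substructure_iff_embedding)
  ultimately have "embedding L (M\<lparr>univ := h ` T\<rparr>) M (inv_into T h)"
    using embedding_comp[of L _ _ "inv_into T h" M id] by simp
  moreover have "is_model L (M\<lparr>univ := h ` T\<rparr>)"
    using is_model_image[OF *(4,3)] by simp
  ultimately show ?thesis
    using * by (auto simp: partial_aut_def embedding_def)
qed

lemma partial_aut_forth:
  assumes "extension_property L Z M" "locally_in L Z M" "\<And>B. B \<in> Z \<Longrightarrow> is_model L B"
    and p: "partial_aut L M (T, h)" and x: "x \<in> univ M"
  obtains T' h' where "partial_aut L M (T', h')" "T \<subseteq> T'" "x \<in> T'" "\<And>y. y \<in> T \<Longrightarrow> h' y = h y"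
proof -
  have *: "finite T" "T \<subseteq> univ M" "is_model L (M\<lparr>univ := T\<rparr>)" "embedding L (M\<lparr>univ := T\<rparr>) M h"
    using p by (auto simp: partial_aut_def)
  obtain T' where T': "finite T'" "insert x T \<subseteq> T'" "T' \<subseteq> univ M" "M\<lparr>univ := T'\<rparr> \<in> Z"
    using locally_inD[OF assms(2), of "insert x T"] * x by auto
  obtain h' where "embedding L (M\<lparr>univ := T'\<rparr>) M h'" "\<And>y. y \<in> T \<Longrightarrow> h' y = h y"
    using extension_propertyD[OF assms(1) T'(4), of T h] T'(2) * by auto
  with T' assms(3) show thesis
    by (intro that[of T' h']) (auto simp: partial_aut_def)
qed

text \<open>The back step is the forth step for the inverse map, inverted again.\<close>

lemma partial_aut_back:
  assumes "extension_property L Z M" "locally_in L Z M" "\<And>B. B \<in> Z \<Longrightarrow> is_model L B"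
    and p: "partial_aut L M (T, h)" and x: "x \<in> univ M"
  obtains T' h' where "partial_aut L M (T', h')" "T \<subseteq> T'" "x \<in> h' ` T'" "\<And>y. y \<in> T \<Longrightarrow> h' y = h y"
proof -
  have inj: "inj_on h T"
    using p by (auto simp: partial_aut_def embedding_def)
  obtain U k where Uk: "partial_aut L M (U, k)" "h ` T \<subseteq> U" "x \<in> U"
      "\<And>y. y \<in> h ` T \<Longrightarrow> k y = inv_into T h y"
    using partial_aut_forth[OF assms(1-3) partial_aut_inverse[OF p] x] by blast
  have injk: "inj_on k U"
    using Uk(1) by (auto simp: partial_aut_def embedding_def)
  have kh: "k (h y) = y" if "y \<in> T" for y
    using that Uk(4) inj by simp
  have "T \<subseteq> k ` U"
    using kh Uk(2) by (metis image_subset_iff rev_image_eqI subsetI)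
  moreover have "x \<in> inv_into U k ` k ` U"
    using Uk(3) injk by (simp add: image_image)
  moreover have "inv_into U k y = h y" if "y \<in> T" for y
    using that kh Uk(2) injk by (metis image_subset_iff inv_into_f_f)
  ultimately show thesis
    using that[OF partial_aut_inverse[OF Uk(1)]] by blast
qed

lemma partial_aut_back_and_forth:
  assumes "extension_property L Z M" "locally_in L Z M" "\<And>B. B \<in> Z \<Longrightarrow> is_model L B"
    and p: "partial_aut L M (T, h)" and x: "x \<in> univ M"
  obtains T' h' where "partial_aut L M (T', h')" "T \<subseteq> T'" "x \<in> T'" "x \<in> h' ` T'"
    "\<And>y. y \<in> T \<Longrightarrow> h' y = h y"
proof -
  obtain T1 h1 where 1: "partial_aut L M (T1, h1)" "T \<subseteq> T1" "x \<in> T1" "\<And>y. y \<in> T \<Longrightarrow> h1 y = h y"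
    using partial_aut_forth[OF assms] by blast
  obtain T' h' where 2: "partial_aut L M (T', h')" "T1 \<subseteq> T'" "x \<in> h' ` T'"
      "\<And>y. y \<in> T1 \<Longrightarrow> h' y = h1 y"
    using partial_aut_back[OF assms(1-3) 1(1) x] by blast
  show thesis
    using that[OF 2(1)] 1 2 by (metis subsetD subset_trans)
qed

text \<open>A set \<open>T\<close> that contains the images of the generators and carries a model is
  closed under the functions, so it contains the image of everything generated.\<close>

lemma finitely_generated_image_locally_in:
  assumes A: "finitely_generated L A" "is_model L A" and h: "embedding L A M h"
    and loc: "locally_in L Z M" and Z: "\<And>B. B \<in> Z \<Longrightarrow> is_model L B"
  obtains T where "finite T" "h ` univ A \<subseteq> T" "T \<subseteq> univ M" "M\<lparr>univ := T\<rparr> \<in> Z"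
proof -
  obtain X where X: "finite X" "X \<subseteq> univ A" "generated L A X = univ A"
    using A by (auto simp: finitely_generated_def)
  moreover have "h ` X \<subseteq> univ M"
    using h X by (auto simp: embedding_def)
  ultimately obtain T where T: "finite T" "h ` X \<subseteq> T" "T \<subseteq> univ M" "M\<lparr>univ := T\<rparr> \<in> Z"
    using locally_inD[OF loc, of "h ` X"] by (metis finite_imageI)
  have "x \<in> univ A \<and> h x \<in> T" if "x \<in> generated L A X" for x
    using that
  proof induction
    case (base x)
    then show ?case using X T by auto
  next
    case (step f xs)
    then have xs: "xs \<in> tuples A (fun_arity L f)" and "set (map h xs) \<subseteq> T"
      by (auto simp: tuples_def)
    moreover have "is_model L (M\<lparr>univ := T\<rparr>)"
      using Z T by auto
    ultimately have "fun_int M f (map h xs) \<in> T"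
      using step by (auto simp: is_model_def tuples_def)
    moreover have "h (fun_int A f xs) = fun_int M f (map h xs)" "fun_int A f xs \<in> univ A"
      using xs step h A(2) by (auto simp: embedding_def is_model_def)
    ultimately show ?case by simp
  qed
  then show thesis
    using that[OF T(1) _ T(3,4)] X(3) by blast
qed

lemma finite_substructure_locally_in:
  assumes "substructure L A M" "finitely_generated L A"
    "locally_in L Z M" "\<And>B. B \<in> Z \<Longrightarrow> is_model L B"
  shows "finite (univ A)"
proof -
  have A: "is_model L A" "embedding L A M id"
    using assms(1) by (simp_all add: substructure_iff_embedding)
  obtain T where "finite T" "id ` univ A \<subseteq> T"
    using finitely_generated_image_locally_in[OF assms(2) A assms(3,4)] by metis
  then show ?thesis
    by (auto intro: finite_subset)
qed

text \<open>Each clause in the definition of an embedding speaks of finitely many points at a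
  time.\<close>

lemma embedding_locally:
  assumes "\<And>X. finite X \<Longrightarrow> X \<subseteq> univ A \<Longrightarrow>
      \<exists>T. X \<subseteq> T \<and> T \<subseteq> univ A \<and> embedding L (A\<lparr>univ := T\<rparr>) B g"
  shows "embedding L A B g"
proof -
  have "g x \<in> univ B \<and> (g x = g y \<longrightarrow> x = y)" if xy: "x \<in> univ A" "y \<in> univ A" for x y
    using assms[of "{x, y}"] xy by (auto simp: embedding_def inj_on_def)
  moreover have "g (fun_int A f xs) = fun_int B f (map g xs)"
    if "f \<in> fun_syms L" "xs \<in> tuples A (fun_arity L f)" for f xs
    using assms[of "set xs"] that by (auto simp: embedding_def tuples_def)
  moreover have "rel_int A r xs \<longleftrightarrow> rel_int B r (map g xs)"
    if "r \<in> rel_syms L" "xs \<in> tuples A (rel_arity L r)" for r xs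
    using assms[of "set xs"] that by (auto simp: embedding_def tuples_def)
  ultimately show ?thesis
    by (auto simp: embedding_def inj_on_def)
qed

lemma homogeneousI:
  assumes ext: "extension_property L Z M" and loc: "locally_in L Z M"
    and Z: "\<And>B. B \<in> Z \<Longrightarrow> is_model L B"
    and M: "countable (univ M)" "is_model L M"
  shows "homogeneous L M"
  unfolding homogeneous_def
proof (intro allI impI, elim conjE)
  fix A B h
  assume A: "substructure L A M" "finitely_generated L A" and B: "substructure L B M"
    and h: "isomorphism L A B h"
  have "embedding L (M\<lparr>univ := univ A\<rparr>) A id"
    using substructure_eq_univ_update[OF A(1)] by (simp add: isomorphism_def)
  moreover have "embedding L A M h"
    using h B embedding_comp[of L A B h M id] by (simp add: isomorphism_def substructure_iff_embedding)
  ultimately have "embedding L (M\<lparr>univ := univ A\<rparr>) M h"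
    using embedding_comp[of L _ A id M h] by simp
  then have start: "partial_aut L M (univ A, h)"
    using finite_substructure_locally_in[OF A loc Z] substructure_eq_univ_update[OF A(1)] A(1)
    by (simp add: partial_aut_def substructure_def)
  have ne: "univ M \<noteq> {}"
    using M(2) by (simp add: is_model_def)
  define e where "e = from_nat_into (univ M)"
  have e: "range e = univ M"
    using range_from_nat_into[OF ne M(1)] by (simp add: e_def)
  \<comment> \<open>Stage \<open>n\<close> takes the \<open>n\<close>-th point of \<open>M\<close>
    into both the domain and the image, so that the union of the maps is total and onto.\<close>
  let ?Q = "\<lambda>(n::nat) x y. fst x \<subseteq> fst y \<and> e n \<in> fst y \<and> e n \<in> snd y ` fst y \<and> (\<forall>z\<in>fst x. snd y z = snd x z)"
  \<comment> \<open>The conjunct for \<open>n = 0\<close> pins the first term, which dependent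
    choice would otherwise leave free.\<close>
  have "\<exists>p. \<forall>n. (partial_aut L M (p n) \<and> (n = 0 \<longrightarrow> p n = (univ A, h))) \<and> ?Q (n::nat) (p n) (p (Suc n))"
  proof (rule dependent_nat_choice)
    show "\<exists>x. partial_aut L M x \<and> ((0::nat) = 0 \<longrightarrow> x = (univ A, h))"
      using start by blast
  next
    fix x and n :: nat
    assume "partial_aut L M x \<and> (n = 0 \<longrightarrow> x = (univ A, h))"
    then have "partial_aut L M (fst x, snd x)" by simp
    moreover have "e n \<in> univ M" using e by blast
    ultimately obtain T' h' where "partial_aut L M (T', h')" "?Q n x (T', h')"
      using partial_aut_back_and_forth[OF ext loc Z, of "fst x" "snd x" "e n"]
      by (metis fst_conv snd_conv)
    then show "\<exists>y. (partial_aut L M y \<and> (Suc n = 0 \<longrightarrow> y = (univ A, h))) \<and> ?Q n x y"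
      by blast
  qed
  then obtain p where p: "\<And>n. (partial_aut L M (p n) \<and> (n = 0 \<longrightarrow> p n = (univ A, h))) \<and> ?Q n (p n) (p (Suc n))"
    by (auto simp del: split_paired_Ex)
  have p0: "p 0 = (univ A, h)" and pa: "partial_aut L M (p n)" and Q: "?Q n (p n) (p (Suc n))" for n
    using p[of 0] p[of n] by blast+
  define T where "T n = fst (p n)" for n
  define H where "H n = snd (p n)" for n
  have T_mono: "T m \<subseteq> T n" if "m \<le> n" for m n
  proof (rule lift_Suc_mono_le[OF _ that])
    show "T n \<subseteq> T (Suc n)" for n
      using Q[of n] by (simp add: T_def)
  qed
  have H_mono: "m \<le> n \<Longrightarrow> x \<in> T m \<Longrightarrow> H n x = H m x" for m n x
  proof (induction n rule: dec_induct)
    case (step n)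
    then have "x \<in> T n" using T_mono by blast
    then show ?case using Q[of n] step by (auto simp: T_def H_def)
  qed simp
  \<comment> \<open>The maps \<open>H n\<close> extend each other, so every stage whose domain
    contains \<open>x\<close> gives the same value; the least one is merely a choice.\<close>
  define g where "g x = H (LEAST n. x \<in> T n) x" for x
  have gH: "g x = H n x" if "x \<in> T n" for x n
    unfolding g_def using that by (metis H_mono LeastI Least_le)
  have TM: "T n \<subseteq> univ M" "is_model L (M\<lparr>univ := T n\<rparr>)" "embedding L (M\<lparr>univ := T n\<rparr>) M (H n)" for n
    using pa[of n] by (simp_all add: T_def H_def partial_aut_def case_prod_beta)
  have gT: "embedding L (M\<lparr>univ := T n\<rparr>) M g" for n
    using TM(3,2) by (rule embedding_cong) (simp add: gH)
  have e_T: "e n \<in> T (Suc n)" "e n \<in> g ` T (Suc n)" for n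
  proof -
    show "e n \<in> T (Suc n)"
      using Q[of n] by (simp add: T_def)
    have "H (Suc n) ` T (Suc n) = g ` T (Suc n)"
      by (simp add: gH)
    then show "e n \<in> g ` T (Suc n)"
      using Q[of n] by (simp add: T_def H_def)
  qed
  have cover: "\<exists>n. X \<subseteq> T n" if "finite X" "X \<subseteq> univ M" for X
    using that
  proof (induction X)
    case (insert x X)
    moreover have "x \<in> range e"
      using insert e by simp
    ultimately obtain m n where "X \<subseteq> T m" "x = e n"
      by auto
    then have "insert x X \<subseteq> T (max m (Suc n))"
      using T_mono[of m "max m (Suc n)"] T_mono[of "Suc n" "max m (Suc n)"] e_T(1)[of n] by auto
    then show ?case by blast
  qed simp
  have g: "embedding L M M g"
  proof (rule embedding_locally)
    fix X assume "finite X" "X \<subseteq> univ M"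
    then obtain n where "X \<subseteq> T n"
      using cover by blast
    then show "\<exists>T. X \<subseteq> T \<and> T \<subseteq> univ M \<and> embedding L (M\<lparr>univ := T\<rparr>) M g"
      using TM(1)[of n] gT[of n] by blast
  qed
  have "e n \<in> g ` univ M" for n
    using e_T(2)[of n] TM(1)[of "Suc n"] by blast
  then have "range e \<subseteq> g ` univ M"
    by blast
  then have "univ M \<subseteq> g ` univ M"
    using e by simp
  then have onto: "g ` univ M = univ M"
    using g by (auto simp: embedding_def)
  let ?g = "restrict g (univ M)"
  have "embedding L M M ?g"
    using g M(2) by (rule embedding_cong) simp
  moreover have "bij_betw ?g (univ M) (univ M)"
    using onto g by (auto simp: bij_betw_def embedding_def inj_on_def)
  ultimately have "?g \<in> automorphisms L M"
    by (auto simp: automorphisms_def Bij_def isomorphism_def bij_betw_def)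
  moreover have "\<forall>x\<in>univ A. ?g x = h x"
    using A(1) p0 gH[of _ 0] by (auto simp: T_def H_def substructure_def)
  ultimately show "\<exists>g\<in>automorphisms L M. \<forall>x\<in>univ A. g x = h x"
    by blast
qed

lemma age_eqI:
  assumes ext: "extension_property L Z M" and loc: "locally_in L Z M"
    and Z: "\<And>B. B \<in> Z \<Longrightarrow> is_model L B \<and> finitely_generated L B"
    and "iso_closed L Z" "hereditary L Z" "joint_embedding L Z"
  shows "age L M = Z"
proof (intro equalityI subsetI)
  fix A assume "A \<in> age L M"
  then obtain h where A: "is_model L A" "finitely_generated L A" and h: "embedding L A M h"
    by (auto simp: age_def embeddable_def)
  obtain T where T: "finite T" "h ` univ A \<subseteq> T" "T \<subseteq> univ M" "M\<lparr>univ := T\<rparr> \<in> Z"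
    using finitely_generated_image_locally_in[OF A(2,1) h loc] Z by metis
  have img: "is_model L (M\<lparr>univ := h ` univ A\<rparr>)"
    using is_model_image[OF h A(1)] .
  moreover have "finitely_generated L (M\<lparr>univ := h ` univ A\<rparr>)"
    using img T by (intro finitely_generated_finite) (auto intro: finite_subset)
  moreover have "substructure L (M\<lparr>univ := h ` univ A\<rparr>) (M\<lparr>univ := T\<rparr>)"
    using img T(2) by (auto simp: substructure_def)
  ultimately have *: "M\<lparr>univ := h ` univ A\<rparr> \<in> Z"
    using assms(5) T(4) unfolding hereditary_def by blast
  have "isomorphic L (M\<lparr>univ := h ` univ A\<rparr>) A"
    using isomorphism_inv_into[OF isomorphism_onto_image[OF h] A(1)] by (auto simp: isomorphic_def)
  then show "A \<in> Z"
    using assms(4) A(1) * unfolding iso_closed_def by blast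
next
  fix B assume B: "B \<in> Z"
  \<comment> \<open>The extension property only extends maps already given on a model, and models
    are nonempty. The empty set yields some member of the class inside \<open>M\<close>; it is
    embedded jointly with \<open>B\<close>, and its inclusion into \<open>M\<close> is then
    extended.\<close>
  obtain T where T: "T \<subseteq> univ M" "M\<lparr>univ := T\<rparr> \<in> Z"
    using locally_inD[OF loc, of "{}"] by auto
  let ?N = "M\<lparr>univ := T\<rparr>"
  obtain C f k where C: "C \<in> Z" "embedding L ?N C f" "embedding L B C k"
    using assms(6) T(2) B unfolding joint_embedding_def embeddable_def by blast
  have N: "is_model L ?N" using T(2) Z by blast
  have "embedding L (C\<lparr>univ := f ` T\<rparr>) ?N (inv_into T f)"
    using embedding_inv_into[OF C(2) N] by simp
  moreover have "embedding L ?N M id"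
    using N T(1) substructure_univ_update[of T M L] by (simp add: substructure_iff_embedding)
  ultimately have "embedding L (C\<lparr>univ := f ` T\<rparr>) M (inv_into T f)"
    using embedding_comp[of L _ ?N _ M id] by simp
  moreover have "is_model L (C\<lparr>univ := f ` T\<rparr>)"
    using is_model_image[OF C(2) N] by simp
  moreover have "f ` T \<subseteq> univ C"
    using C(2) by (simp add: embedding_def)
  ultimately obtain g where "embedding L C M g"
    using extension_propertyD[OF ext C(1)] by metis
  then have "embedding L B M (g \<circ> k)"
    using embedding_comp[OF C(3)] by blast
  then show "B \<in> age L M"
    using Z B by (auto simp: age_def embeddable_def)
qed

subsection \<open>Existence of Fraisse limits\<close>

text \<open>\<open>P\<close> and \<open>B\<close> are amalgamated over \<open>S\<close>, and the
  amalgam is renamed so that it literally contains \<open>P\<close>. A sequence of such steps is an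
  increasing chain whose limit is a plain union.\<close>

lemma fraisse_step:
  fixes Z :: "nat model set"
  assumes Z: "fraisse_class L Z" "\<forall>M\<in>Z. finite (univ M)"
    and P: "P \<in> Z" and B: "B \<in> Z"
    and S: "S \<subseteq> univ B" "is_model L (B\<lparr>univ := S\<rparr>)" and h: "embedding L (B\<lparr>univ := S\<rparr>) P h"
  obtains Q g where "Q \<in> Z" "substructure L P Q" "embedding L B Q g" "\<And>x. x \<in> S \<Longrightarrow> g x = h x"
proof -
  let ?A = "B\<lparr>univ := S\<rparr>"
  have model: "is_model L M" if "M \<in> Z" for M
    using Z that by (auto simp: fraisse_class_def)
  have sub: "substructure L ?A B"
    using S by (simp add: substructure_univ_update)
  moreover have "finitely_generated L ?A"
    using S Z(2) B by (intro finitely_generated_finite) (auto intro: finite_subset)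
  ultimately have "?A \<in> Z"
    using Z(1) B unfolding fraisse_class_def hereditary_def by blast
  moreover have "embedding L ?A B id"
    using sub by (simp add: substructure_iff_embedding)
  ultimately have "\<exists>D\<in>Z. \<exists>f' g'. embedding L P D f' \<and> embedding L B D g' \<and> (\<forall>x\<in>S. f' (h x) = g' (id x))"
    using Z(1) P B h unfolding fraisse_class_def amalgamation_def by fastforce
  then obtain D f' g' where D: "D \<in> Z" and f': "embedding L P D f'" and g': "embedding L B D g'"
      and eq: "\<And>x. x \<in> S \<Longrightarrow> f' (h x) = g' x"
    by auto
  have injf: "inj_on f' (univ P)"
    using f' by (simp add: embedding_def)
  obtain \<sigma> where \<sigma>: "inj \<sigma>" "\<And>x. x \<in> f' ` univ P \<Longrightarrow> \<sigma> x = inv_into (univ P) f' x"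
    using inj_extension_avoiding[of "inv_into (univ P) f'" "f' ` univ P" "{}"] Z(2) P
    by (metis finite.emptyI finite_imageI inj_on_inv_into order_refl)
  have \<sigma>f: "\<sigma> (f' x) = x" if "x \<in> univ P" for x
    using that \<sigma>(2) injf by simp
  let ?Q = "map_model \<sigma> D"
  have inj: "inj_on \<sigma> (univ D)"
    using \<sigma>(1) by (rule inj_on_subset) simp
  have iso: "isomorphism L D ?Q \<sigma>"
    using inj by (rule isomorphism_map_model)
  then have emb: "embedding L D ?Q \<sigma>"
    by (simp add: isomorphism_def)
  have "?Q \<in> Z"
    using Z(1) D iso is_model_map_model[OF inj model[OF D]]
    unfolding fraisse_class_def iso_closed_def isomorphic_def by blast
  moreover have "embedding L P ?Q (\<sigma> \<circ> f')"
    using f' emb by (rule embedding_comp)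
  then have "embedding L P ?Q id"
    using model[OF P] by (rule embedding_cong) (simp add: \<sigma>f)
  then have "substructure L P ?Q"
    using model[OF P] by (simp add: substructure_iff_embedding)
  moreover have "embedding L B ?Q (\<sigma> \<circ> g')"
    using g' emb by (rule embedding_comp)
  moreover have "(\<sigma> \<circ> g') x = h x" if "x \<in> S" for x
  proof -
    have "h x \<in> univ P"
      using h that by (auto simp: embedding_def)
    then show ?thesis
      using \<sigma>f eq[OF that] by (metis comp_apply)
  qed
  ultimately show thesis
    by (rule that)
qed

text \<open>As total functions the interpretations of different stages may disagree off the smaller
  universe. The union reads a tuple at the first stage that contains it, with which all later stages
  agree.\<close>

lemma substructure_chain_union:
  fixes P :: "nat \<Rightarrow> 'a model"
  assumes P: "\<And>n. is_model L (P n)" and chain: "\<And>n. substructure L (P n) (P (Suc n))"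
  obtains M where "univ M = (\<Union>n. univ (P n))" "is_model L M" "\<And>n. substructure L (P n) M"
    "\<And>m n. m \<le> n \<Longrightarrow> substructure L (P m) (P n)"
    "\<And>X. finite X \<Longrightarrow> X \<subseteq> univ M \<Longrightarrow> \<exists>n. X \<subseteq> univ (P n)"
proof -
  have mono: "m \<le> n \<Longrightarrow> substructure L (P m) (P n)" for m n
  proof (induction n rule: dec_induct)
    case base
    then show ?case using P by (auto simp: substructure_def)
  next
    case (step n)
    then show ?case using chain substructure_trans by blast
  qed
  define k where "k xs = (LEAST k. set xs \<subseteq> univ (P k))" for xs
  define M where "M = \<lparr>univ = (\<Union>n. univ (P n)), fun_int = \<lambda>f xs. fun_int (P (k xs)) f xs,
     rel_int = \<lambda>r xs. rel_int (P (k xs)) r xs\<rparr>"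
  have k: "substructure L (P (k xs)) (P n)" "xs \<in> tuples (P (k xs)) m" if "xs \<in> tuples (P n) m" for xs n m
  proof -
    have "set xs \<subseteq> univ (P n)" using that by (simp add: tuples_def)
    then have "k xs \<le> n" "set xs \<subseteq> univ (P (k xs))"
      unfolding k_def by (auto intro: Least_le dest: LeastI[of "\<lambda>k. set xs \<subseteq> univ (P k)"])
    then show "substructure L (P (k xs)) (P n)" "xs \<in> tuples (P (k xs)) m"
      using that mono by (auto simp: tuples_def)
  qed
  have PM: "substructure L (P n) M" for n
    unfolding substructure_def
  proof (intro conjI ballI)
    show "univ (P n) \<subseteq> univ M" by (auto simp: M_def)
  next
    fix f xs assume "f \<in> fun_syms L" "xs \<in> tuples (P n) (fun_arity L f)"
    then show "fun_int (P n) f xs = fun_int M f xs"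
      using k[of xs n "fun_arity L f"] by (simp add: M_def substructure_def)
  next
    fix r xs assume "r \<in> rel_syms L" "xs \<in> tuples (P n) (rel_arity L r)"
    then show "rel_int (P n) r xs \<longleftrightarrow> rel_int M r xs"
      using k[of xs n "rel_arity L r"] by (simp add: M_def substructure_def)
  qed (rule P)
  have fin: "\<exists>n. X \<subseteq> univ (P n)" if "finite X" "X \<subseteq> univ M" for X
    using that
  proof (induction X)
    case (insert x X)
    then obtain m n where "X \<subseteq> univ (P m)" "x \<in> univ (P n)"
      by (auto simp: M_def)
    moreover have "univ (P m) \<subseteq> univ (P (max m n))" "univ (P n) \<subseteq> univ (P (max m n))"
      using mono[of m "max m n"] mono[of n "max m n"] by (auto simp: substructure_def)
    ultimately show ?case by blast
  qed simp
  have "is_model L M"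
    unfolding is_model_def
  proof (intro conjI ballI)
    show "univ M \<noteq> {}" using P[of 0] by (auto simp: M_def is_model_def)
  next
    fix f xs assume f: "f \<in> fun_syms L" and xs: "xs \<in> tuples M (fun_arity L f)"
    then obtain n where "set xs \<subseteq> univ (P n)"
      using fin[of "set xs"] by (auto simp: tuples_def)
    then have "xs \<in> tuples (P n) (fun_arity L f)"
      using xs by (simp add: tuples_def)
    then have "fun_int M f xs = fun_int (P n) f xs" "fun_int (P n) f xs \<in> univ (P n)"
      using f PM[of n] P[of n] by (simp_all add: substructure_def is_model_def)
    then show "fun_int M f xs \<in> univ M"
      using PM[of n] by (auto simp: substructure_def)
  qed
  with mono PM fin show thesis
    by (intro that[of M]) (simp_all add: M_def)
qed

theorem fraisse_limit_exists:
  fixes Z :: "nat model set"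
  assumes Z: "fraisse_class L Z" "\<forall>M\<in>Z. finite (univ M)" and ne: "Z \<noteq> {}"
  shows "\<exists>F :: nat model. fraisse_limit L Z F"
proof -
  have model: "is_model L M" "finitely_generated L M" if "M \<in> Z" for M
    using Z that by (auto simp: fraisse_class_def)
  obtain R where R: "countable R" "R \<subseteq> Z" "\<forall>A\<in>Z. \<exists>B\<in>R. isomorphic L A B"
    using Z(1) by (auto simp: fraisse_class_def countably_many_iso_types_def)
  then have "R \<noteq> {}" using ne by blast
  define r where "r = from_nat_into R"
  have r: "range r = R"
    using range_from_nat_into[OF \<open>R \<noteq> {}\<close> R(1)] by (simp add: r_def)
  then have rZ: "r i \<in> Z" for i using R(2) by blast
  \<comment> \<open>The first component of the pair is ignored, so that every task recurs at arbitrarily late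
    stages. A map on a finite set of numbers is coded as a list.\<close>
  define task where "task n = (from_nat (snd (prod_decode n)) :: nat \<times> nat list \<times> nat list)" for n
  let ?emb = "\<lambda>i s hs X. set s \<subseteq> univ (r i) \<and> is_model L ((r i)\<lparr>univ := set s\<rparr>) \<and>
      embedding L ((r i)\<lparr>univ := set s\<rparr>) X (nth hs)"
  let ?ext = "\<lambda>i s hs Y. \<exists>g. embedding L (r i) Y g \<and> (\<forall>x\<in>set s. g x = hs ! x)"
  let ?Q = "\<lambda>n X Y. substructure L X Y \<and> (\<forall>i s hs. task n = (i, s, hs) \<and> ?emb i s hs X \<longrightarrow> ?ext i s hs Y)"
  have "\<exists>P. \<forall>n. P n \<in> Z \<and> ?Q n (P n) (P (Suc n))"
  proof (rule dependent_nat_choice)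
    show "\<exists>X. X \<in> Z" using ne by blast
  next
    fix X and n :: nat assume X: "X \<in> Z"
    obtain i s hs where t: "task n = (i, s, hs)" by (metis prod_cases3)
    show "\<exists>Y. Y \<in> Z \<and> ?Q n X Y"
    proof (cases "?emb i s hs X")
      case True
      then obtain Y g where "Y \<in> Z" "substructure L X Y" "embedding L (r i) Y g" "\<And>x. x \<in> set s \<Longrightarrow> g x = hs ! x"
        using fraisse_step[OF Z X rZ, of "set s" i "nth hs"] by blast
      then show ?thesis using t by auto
    next
      \<comment> \<open>A code that describes no embedding into the current model sets no task, and
        the model is kept.\<close>
      case False
      moreover have "substructure L X X"
        using model(1)[OF X] by (simp add: substructure_def)
      ultimately show ?thesis using X t by auto
    qed
  qed
  then obtain P where P: "\<And>n. P n \<in> Z \<and> ?Q n (P n) (P (Suc n))"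
    by blast
  obtain M where M: "univ M = (\<Union>n. univ (P n))" "is_model L M" "\<And>n. substructure L (P n) M"
      and mono: "\<And>m n. m \<le> n \<Longrightarrow> substructure L (P m) (P n)"
      and fin: "\<And>X. finite X \<Longrightarrow> X \<subseteq> univ M \<Longrightarrow> \<exists>n. X \<subseteq> univ (P n)"
    using substructure_chain_union[of L P] P model(1) by metis
  have PM: "M\<lparr>univ := univ (P n)\<rparr> \<in> Z" for n
  proof -
    note * = substructure_eq_univ_update[OF M(3)[of n]]
    have "isomorphic L (P n) (M\<lparr>univ := univ (P n)\<rparr>)"
      using isomorphism_inv_into[OF *(2,1)] by (auto simp: isomorphic_def)
    then show ?thesis
      using P[of n] Z(1) *(1) unfolding fraisse_class_def iso_closed_def by blast
  qed
  have loc: "locally_in L Z M"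
    unfolding locally_in_def
  proof (intro allI impI)
    fix X assume "finite X \<and> X \<subseteq> univ M"
    then obtain n where "X \<subseteq> univ (P n)" using fin by blast
    moreover have "finite (univ (P n))" "univ (P n) \<subseteq> univ M"
      using P[of n] Z(2) M(1) by auto
    ultimately show "\<exists>T. finite T \<and> X \<subseteq> T \<and> T \<subseteq> univ M \<and> M\<lparr>univ := T\<rparr> \<in> Z"
      using PM[of n] by blast
  qed
  have "extension_property L R M"
    unfolding extension_property_def
  proof (intro ballI allI impI)
    fix B S h
    assume B: "B \<in> R" and S: "S \<subseteq> univ B" and h: "is_model L (B\<lparr>univ := S\<rparr>) \<and> embedding L (B\<lparr>univ := S\<rparr>) M h"
    obtain i where i: "B = r i" using B r by blast
    have "finite S"
      using S B R(2) Z(2) by (auto intro: finite_subset)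
    then obtain s where s: "S = set s" by (metis finite_list)
    obtain n where n: "h ` S \<subseteq> univ (P n)"
      using fin[of "h ` S"] \<open>finite S\<close> h by (auto simp: embedding_def)
    obtain N where N: "S \<subseteq> {..<N}"
      using \<open>finite S\<close> finite_nat_iff_bounded by blast
    define hs where "hs = map h [0..<N]"
    have hs: "hs ! x = h x" if "x \<in> S" for x
      using that N by (auto simp: hs_def)
    have "embedding L (B\<lparr>univ := S\<rparr>) M (nth hs)"
      using h hs by (intro embedding_cong[of L _ M h "nth hs"]) auto
    moreover have "nth hs ` S \<subseteq> univ (P n)"
      using n hs by (simp add: image_subset_iff)
    ultimately have emb: "embedding L (B\<lparr>univ := S\<rparr>) (P n) (nth hs)"
      by (intro embedding_into_substructure[OF _ M(3)]) simp_all
    \<comment> \<open>The code of a pair is at least its first component, so stage \<open>m\<close>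
      comes no earlier than stage \<open>n\<close>, where the image of \<open>h\<close> is already
      present; its second component is the code of the desired task.\<close>
    define m where "m = prod_encode (n, to_nat (i, s, hs))"
    have "task m = (i, s, hs)" by (simp add: task_def m_def)
    moreover have "substructure L (P n) (P m)"
      by (intro mono) (simp add: m_def le_prod_encode_1)
    then have "embedding L (B\<lparr>univ := S\<rparr>) (P m) (nth hs)"
      using embedding_comp[OF emb, of "P m" id] by (simp add: substructure_iff_embedding)
    ultimately obtain g where g: "embedding L B (P (Suc m)) g" "\<And>x. x \<in> S \<Longrightarrow> g x = hs ! x"
      using P[of m] S h i s by blast
    have "embedding L B M g"
      using embedding_comp[OF g(1), of M id] M(3) by (simp add: substructure_iff_embedding)
    with g(2) hs show "\<exists>g. embedding L B M g \<and> (\<forall>x\<in>S. g x = h x)"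
      by (intro exI[of _ g]) auto
  qed
  then have ext: "extension_property L Z M"
    using extension_property_iso_types model(1) R(3) by blast
  have "homogeneous L M"
    using homogeneousI[OF ext loc model(1) _ M(2)] by simp
  moreover have "age L M = Z"
    using age_eqI[OF ext loc] model Z(1) by (auto simp: fraisse_class_def)
  ultimately have "fraisse_limit L Z M"
    using M(2) by (simp add: fraisse_limit_def)
  then show ?thesis by blast
qed

text \<open>The age provides some embedding of \<open>B\<close>, which may move \<open>A\<close>;
  homogeneity provides an automorphism of \<open>F\<close> that moves the copy of \<open>A\<close>
  back.\<close>

lemma fraisse_limit_extension:
  assumes F: "fraisse_limit L Z F" and A: "substructure L A F" "finitely_generated L A"
    and B: "B \<in> Z" "substructure L A B" "finite (univ B)"
  obtains g where "embedding L B F g" "\<And>x. x \<in> univ A \<Longrightarrow> g x = x"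
proof -
  have "B \<in> age L F" using F B(1) by (simp add: fraisse_limit_def)
  then obtain e where e: "embedding L B F e"
    by (auto simp: age_def embeddable_def)
  have mA: "is_model L A" using A by (simp add: substructure_def)
  have eA: "embedding L A F e"
    using B(2) embedding_comp[of L A B id F e] e by (simp add: substructure_iff_embedding)
  let ?B = "F\<lparr>univ := e ` univ A\<rparr>"
  have mB: "is_model L ?B" and iso: "isomorphism L ?B A (inv_into (univ A) e)"
    using is_model_image[OF eA mA] isomorphism_inv_into[OF isomorphism_onto_image[OF eA] mA]
    by simp_all
  moreover have "substructure L ?B F"
    using mB eA by (simp add: substructure_univ_update embedding_def)
  moreover have "finitely_generated L ?B"
    using mB B(2,3) by (intro finitely_generated_finite) (auto simp: substructure_def intro: finite_subset)
  ultimately obtain g where g: "g \<in> automorphisms L F" "\<And>y. y \<in> e ` univ A \<Longrightarrow> g y = inv_into (univ A) e y"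
    using F A unfolding fraisse_limit_def homogeneous_def
    by (metis model.select_convs(1) model.update_convs(1) model.surjective)
  have "embedding L B F (g \<circ> e)"
    using embedding_comp[OF e, of F g] g(1) by (auto simp: automorphisms_def isomorphism_def)
  moreover have "(g \<circ> e) x = x" if "x \<in> univ A" for x
    using that g(2) eA by (simp add: embedding_def)
  ultimately show thesis by (rule that)
qed

subsection \<open>Automorphism groups of models\<close>

lemma automorphisms_iff:
  "g \<in> automorphisms L A \<longleftrightarrow> g \<in> extensional (univ A) \<and> isomorphism L A A g"
  by (auto simp: automorphisms_def Bij_def isomorphism_def embedding_def bij_betw_def)

lemma automorphism_closed: "g \<in> automorphisms L A \<Longrightarrow> x \<in> univ A \<Longrightarrow> g x \<in> univ A"
  by (auto simp: automorphisms_iff isomorphism_def)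

lemma Aut_simps:
  shows "carrier (Aut L A) = automorphisms L A" "\<one>\<^bsub>Aut L A\<^esub> = (\<lambda>x\<in>univ A. x)"
    "g \<in> automorphisms L A \<Longrightarrow> h \<in> automorphisms L A \<Longrightarrow> g \<otimes>\<^bsub>Aut L A\<^esub> h = compose (univ A) g h"
  by (simp_all add: Aut_def BijGroup_def automorphisms_def)

lemma subgroup_automorphisms:
  assumes A: "is_model L A"
  shows "subgroup (automorphisms L A) (BijGroup (univ A))"
proof (rule subgroup.intro)
  show "automorphisms L A \<subseteq> carrier (BijGroup (univ A))"
    by (auto simp: automorphisms_def BijGroup_def)
next
  fix g h assume g: "g \<in> automorphisms L A" and h: "h \<in> automorphisms L A"
  then have "embedding L A A (g \<circ> h)"
    by (auto simp: automorphisms_iff isomorphism_def intro: embedding_comp)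
  then have emb: "embedding L A A (compose (univ A) g h)"
    using A by (rule embedding_cong) (simp add: compose_def)
  have "compose (univ A) g h \<in> Bij (univ A)"
    using g h by (auto simp: automorphisms_def intro: compose_Bij)
  then have "compose (univ A) g h \<in> automorphisms L A"
    using emb by (simp add: automorphisms_def isomorphism_def Bij_def bij_betw_def)
  then show "g \<otimes>\<^bsub>BijGroup (univ A)\<^esub> h \<in> automorphisms L A"
    using g h by (simp add: BijGroup_def automorphisms_def)
next
  have "embedding L A A (\<lambda>x\<in>univ A. x)"
    by (rule embedding_cong[of L A A id]) (use A in \<open>auto simp: embedding_def\<close>)
  then show "\<one>\<^bsub>BijGroup (univ A)\<^esub> \<in> automorphisms L A"
    by (simp add: BijGroup_def automorphisms_iff isomorphism_def)
next
  fix g assume g: "g \<in> automorphisms L A"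
  then have B: "g \<in> Bij (univ A)" and iso: "isomorphism L A A g"
    by (auto simp: automorphisms_def)
  let ?h = "\<lambda>x\<in>univ A. inv_into (univ A) g x"
  have "embedding L A A ?h"
    by (rule embedding_cong[of L A A "inv_into (univ A) g"])
      (use isomorphism_inv_into[OF iso A] A in \<open>auto simp: isomorphism_def\<close>)
  moreover have "?h \<in> Bij (univ A)"
    using B by (rule restrict_inv_into_Bij)
  ultimately show "inv\<^bsub>BijGroup (univ A)\<^esub> g \<in> automorphisms L A"
    by (simp only: inv_BijGroup[OF B]) (simp add: automorphisms_def isomorphism_def Bij_def bij_betw_def)
qed

lemma group_Aut: "is_model L A \<Longrightarrow> group (Aut L A)"
  unfolding Aut_def by (intro subgroup.subgroup_is_group subgroup_automorphisms group_BijGroup)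

lemma Aut_pow:
  assumes A: "is_model L A" and g: "g \<in> automorphisms L A" and x: "x \<in> univ A"
  shows "(g [^]\<^bsub>Aut L A\<^esub> (n::nat)) x = (g ^^ n) x"
  using x
proof (induction n arbitrary: x)
  case 0
  then show ?case by (simp add: Aut_simps)
next
  case (Suc n)
  interpret group "Aut L A" using A by (rule group_Aut)
  have "g [^]\<^bsub>Aut L A\<^esub> n \<in> automorphisms L A"
    using g nat_pow_closed[of g n] by (simp add: Aut_simps)
  then have "(g [^]\<^bsub>Aut L A\<^esub> Suc n) x = (g [^]\<^bsub>Aut L A\<^esub> n) (g x)"
    using g Suc.prems by (simp add: Aut_simps compose_def)
  then show ?case
    using Suc automorphism_closed[OF g] by (simp add: funpow_swap1)
qed

text \<open>The order of the finite automorphism group is a common exponent, by Lagrange's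
  theorem.\<close>

lemma finite_Aut_exponent:
  assumes A: "is_model L A" "finite (univ A)"
  shows "\<exists>k>0. \<forall>g\<in>automorphisms L A. \<forall>x\<in>univ A. (g ^^ k) x = x"
proof -
  interpret group "Aut L A" using A(1) by (rule group_Aut)
  have "automorphisms L A \<subseteq> univ A \<rightarrow>\<^sub>E univ A"
  proof
    fix g assume g: "g \<in> automorphisms L A"
    then show "g \<in> univ A \<rightarrow>\<^sub>E univ A"
      using automorphism_closed[OF g] by (simp add: automorphisms_iff PiE_def Pi_def)
  qed
  then have "finite (carrier (Aut L A))"
    using A(2) by (auto simp: Aut_simps intro: finite_subset finite_PiE)
  then have "order (Aut L A) > 0"
    by (simp add: order_gt_0_iff_finite)
  moreover have "(g ^^ order (Aut L A)) x = x" if "g \<in> automorphisms L A" "x \<in> univ A" for g x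
    using that pow_order_eq_1[of g] Aut_pow[OF A(1) that, of "order (Aut L A)"] by (simp add: Aut_simps)
  ultimately show ?thesis by blast
qed

subsection \<open>Layered models\<close>

definition layered_sig :: signature where
  "layered_sig = \<lparr>fun_syms = {0, 1}, fun_arity = \<lambda>_. 1, rel_syms = {0}, rel_arity = \<lambda>_. 2\<rparr>"

definition shift :: "'a model \<Rightarrow> 'a \<Rightarrow> 'a" where
  "shift M x = fun_int M 0 [x]"

definition proj :: "'a model \<Rightarrow> 'a \<Rightarrow> 'a" where
  "proj M x = fun_int M 1 [x]"

definition below :: "'a model \<Rightarrow> 'a \<Rightarrow> 'a \<Rightarrow> bool" where
  "below M x y = rel_int M 0 [x, y]"

lemma univ_update_layered [simp]:
  "shift (M\<lparr>univ := S\<rparr>) = shift M" "proj (M\<lparr>univ := S\<rparr>) = proj M" "below (M\<lparr>univ := S\<rparr>) = below M"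
  by (simp_all add: fun_eq_iff shift_def proj_def below_def)

lemma ball_tuples_1: "(\<forall>xs\<in>tuples A (Suc 0). Q xs) \<longleftrightarrow> (\<forall>x\<in>univ A. Q [x])"
  by (auto simp: tuples_def length_Suc_conv)

lemma ball_tuples_2: "(\<forall>xs\<in>tuples A 2. Q xs) \<longleftrightarrow> (\<forall>x\<in>univ A. \<forall>y\<in>univ A. Q [x, y])"
  by (auto simp: tuples_def length_Suc_conv numeral_2_eq_2)

lemma is_model_layered_sig:
  "is_model layered_sig A \<longleftrightarrow> univ A \<noteq> {} \<and> (\<forall>x\<in>univ A. shift A x \<in> univ A \<and> proj A x \<in> univ A)"
  by (auto simp: is_model_def layered_sig_def ball_tuples_1 shift_def proj_def)

lemma embedding_layered_sig:
  "embedding layered_sig A B h \<longleftrightarrow> h ` univ A \<subseteq> univ B \<and> inj_on h (univ A) \<and>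
     (\<forall>x\<in>univ A. h (shift A x) = shift B (h x) \<and> h (proj A x) = proj B (h x)) \<and>
     (\<forall>x\<in>univ A. \<forall>y\<in>univ A. below A x y \<longleftrightarrow> below B (h x) (h y))"
  by (auto simp: embedding_def layered_sig_def ball_tuples_1 ball_tuples_2 shift_def proj_def below_def)

definition layered_model :: "'a set \<Rightarrow> ('a \<Rightarrow> 'a) \<Rightarrow> ('a \<Rightarrow> 'a) \<Rightarrow> ('a \<Rightarrow> 'a \<Rightarrow> bool) \<Rightarrow> 'a model" where
  "layered_model U s p R = \<lparr>univ = U, fun_int = \<lambda>f xs. if f = 0 then s (hd xs) else p (hd xs),
     rel_int = \<lambda>_ xs. R (hd xs) (xs ! 1)\<rparr>"

lemma layered_model_simps [simp]:
  "univ (layered_model U s p R) = U" "shift (layered_model U s p R) = s"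
  "proj (layered_model U s p R) = p" "below (layered_model U s p R) = R"
  by (simp_all add: layered_model_def shift_def proj_def below_def fun_eq_iff)

text \<open>That \<open>shift\<close> permutes the universe with finite cycles is hidden in the last
  clause: its left side is symmetric in \<open>x\<close> and \<open>y\<close>, so every point is
  reached again from its successor.\<close>

definition layered :: "'a model \<Rightarrow> bool" where
  "layered M \<longleftrightarrow>
     (\<forall>x\<in>univ M. proj M (shift M x) = shift M (proj M x)) \<and>
     (\<forall>x\<in>univ M. \<forall>y\<in>univ M. below M x y \<or> below M y x) \<and>
     (\<forall>x\<in>univ M. \<forall>y\<in>univ M. \<forall>z\<in>univ M. below M x y \<and> below M y z \<longrightarrow> below M x z) \<and>
     (\<forall>x\<in>univ M. \<forall>y\<in>univ M. below M x y \<and> below M y x \<longleftrightarrow> (\<exists>n. (shift M ^^ n) x = y))"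

lemma layeredD:
  assumes "layered M"
  shows "x \<in> univ M \<Longrightarrow> proj M (shift M x) = shift M (proj M x)"
    and "x \<in> univ M \<Longrightarrow> y \<in> univ M \<Longrightarrow> below M x y \<or> below M y x"
    and "x \<in> univ M \<Longrightarrow> y \<in> univ M \<Longrightarrow> z \<in> univ M \<Longrightarrow> below M x y \<Longrightarrow> below M y z \<Longrightarrow> below M x z"
    and "x \<in> univ M \<Longrightarrow> y \<in> univ M \<Longrightarrow> below M x y \<and> below M y x \<longleftrightarrow> (\<exists>n. (shift M ^^ n) x = y)"
  using assms unfolding layered_def by blast+

section \<open>Orbits of the shift\<close>

lemma funpow_shift_closed: "is_model layered_sig M \<Longrightarrow> x \<in> univ M \<Longrightarrow> (shift M ^^ n) x \<in> univ M"
  by (induction n) (auto simp: is_model_layered_sig)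

lemma embedding_funpow_shift:
  assumes "embedding layered_sig A B h" "is_model layered_sig A" "x \<in> univ A"
  shows "h ((shift A ^^ n) x) = (shift B ^^ n) (h x)"
  using assms funpow_shift_closed[OF assms(2,3)] by (induction n) (simp_all add: embedding_layered_sig)

text \<open>All clauses are reflected by embeddings. The existential one is too, because the orbit
  of a point of \<open>A\<close> is computed inside \<open>A\<close>.\<close>

lemma layered_embedding:
  assumes h: "embedding layered_sig A B h" and A: "is_model layered_sig A" and B: "layered B"
  shows "layered A"
proof -
  have hU: "h x \<in> univ B" if "x \<in> univ A" for x
    using h that by (auto simp: embedding_def)
  have inj: "h x = h y \<longleftrightarrow> x = y" if "x \<in> univ A" "y \<in> univ A" for x y
    using h that by (auto simp: embedding_def inj_on_def)
  have h': "h (shift A x) = shift B (h x)" "h (proj A x) = proj B (h x)"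
    "shift A x \<in> univ A" "proj A x \<in> univ A" if "x \<in> univ A" for x
    using h A that by (auto simp: embedding_layered_sig is_model_layered_sig)
  have below: "below A x y \<longleftrightarrow> below B (h x) (h y)" if "x \<in> univ A" "y \<in> univ A" for x y
    using h that by (auto simp: embedding_layered_sig)
  have iter: "(shift A ^^ n) x = y \<longleftrightarrow> (shift B ^^ n) (h x) = h y"
    if "x \<in> univ A" "y \<in> univ A" for x y n
    using that inj embedding_funpow_shift[OF h A] funpow_shift_closed[OF A] by metis
  have "proj A (shift A x) = shift A (proj A x)" if x: "x \<in> univ A" for x
  proof -
    have "h (proj A (shift A x)) = h (shift A (proj A x))"
      using h' x layeredD(1)[OF B hU[OF x]] by simp
    then show ?thesis
      using inj[of "proj A (shift A x)" "shift A (proj A x)"] h'(3,4) x by simp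
  qed
  moreover have "below A x y \<or> below A y x" if "x \<in> univ A" "y \<in> univ A" for x y
    using that layeredD(2)[OF B hU hU] by (simp add: below)
  moreover have "below A x z" if "x \<in> univ A" "y \<in> univ A" "z \<in> univ A" "below A x y" "below A y z" for x y z
    using that layeredD(3)[OF B hU hU hU, of x y z] by (simp add: below)
  moreover have "below A x y \<and> below A y x \<longleftrightarrow> (\<exists>n. (shift A ^^ n) x = y)"
    if "x \<in> univ A" "y \<in> univ A" for x y
    using that layeredD(4)[OF B hU hU, of x y] by (simp add: below iter)
  ultimately show ?thesis
    unfolding layered_def by blast
qed

lemma proj_funpow_shift:
  assumes "layered M" "is_model layered_sig M" "x \<in> univ M"
  shows "proj M ((shift M ^^ n) x) = (shift M ^^ n) (proj M x)"
  by (induction n) (simp_all add: layeredD(1)[OF assms(1) funpow_shift_closed[OF assms(2,3)]])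

lemma shift_periodic:
  assumes "layered M" "is_model layered_sig M" "x \<in> univ M"
  obtains n where "n > 0" "(shift M ^^ n) x = x"
proof -
  have s: "shift M x \<in> univ M"
    using assms by (auto simp: is_model_layered_sig)
  have "(shift M ^^ 1) x = shift M x" by simp
  then have "below M (shift M x) x \<and> below M x (shift M x)"
    using layeredD(4)[OF assms(1,3) s] by blast
  then obtain n where "(shift M ^^ n) (shift M x) = x"
    using layeredD(4)[OF assms(1) s assms(3)] by blast
  then have "(shift M ^^ Suc n) x = x"
    by (simp add: funpow_swap1)
  then show thesis using that[of "Suc n"] by simp
qed


text \<open>The preorder is recovered from the cuts over a shift-closed set \<open>T\<close>; the
  amalgam is ordered by the formula on the right, so this shows that it induces the given preorder
  on each factor. If a point \<open>x\<close> outside \<open>T\<close> and a point \<open>y\<close>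
  of \<open>T\<close> have the same cut, then \<open>y\<close> is in its own cut, hence below
  \<open>x\<close>. Conversely \<open>x\<close> cannot be below \<open>y\<close>, or it would lie on
  the orbit of \<open>y\<close> and so in \<open>T\<close>. If instead a point \<open>t\<close> of
  \<open>T\<close> is below \<open>y\<close> but not below \<open>x\<close>, totality puts it
  between \<open>x\<close> and \<open>y\<close>.\<close>

lemma below_iff_cut:
  assumes N: "layered N" "is_model layered_sig N" and T: "T \<subseteq> univ N" "\<And>x. x \<in> T \<Longrightarrow> shift N x \<in> T"
    and dcut: "\<And>x. x \<in> univ N \<Longrightarrow> dcut x = {t \<in> T. below N t x}"
    and kind: "\<And>x. x \<in> T \<Longrightarrow> kind x = 0" "\<And>x. x \<in> univ N \<Longrightarrow> x \<notin> T \<Longrightarrow> kind x = c" and "c > (0::nat)"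
    and xy: "x \<in> univ N" "y \<in> univ N"
  shows "below N x y \<longleftrightarrow> dcut x \<subset> dcut y \<or> dcut x = dcut y \<and> (kind x < kind y \<or> kind x = kind y \<and> below N x y)"
    (is "_ \<longleftrightarrow> ?R")
proof
  note trans = layeredD(3)[OF N(1)]
  {
    assume le: "below N x y"
    then have "dcut x \<subseteq> dcut y"
      using T(1) trans[OF _ xy _ le] by (auto simp: dcut xy)
    moreover have "kind x \<le> kind y" if eq: "dcut x = dcut y"
    proof (rule ccontr)
      assume "\<not> kind x \<le> kind y"
      then have "y \<in> T \<and> x \<notin> T"
        using kind(1)[of x] kind(1)[of y] kind(2)[OF xy(1)] kind(2)[OF xy(2)]
        by (cases "x \<in> T"; cases "y \<in> T") simp_all
      then have yT: "y \<in> T" and xT: "x \<notin> T" by simp_all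
      have "below N y y"
        using layeredD(2)[OF N(1) xy(2) xy(2)] by simp
      then have "below N y x"
        using yT eq by (auto simp: dcut xy)
      then obtain n where "(shift N ^^ n) y = x"
        using le layeredD(4)[OF N(1) xy(2,1)] by blast
      moreover have "(shift N ^^ n) y \<in> T" for n
        by (induction n) (use yT T(2) in auto)
      ultimately show False using xT by blast
    qed
    ultimately show ?R using le by fastforce
  }
  assume ?R
  then consider t where "t \<in> dcut y" "t \<notin> dcut x" | "dcut x = dcut y" "kind x < kind y" | "below N x y"
    by blast
  then show "below N x y"
  proof cases
    case 1
    then have "t \<in> univ N" "below N t y" "\<not> below N t x"
      using T(1) by (auto simp: dcut xy)
    then show ?thesis
      using layeredD(2)[OF N(1) xy(1), of t] trans[OF xy(1) _ xy(2), of t] by blast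
  next
    case 2
    then have "x \<in> T"
      using kind(1)[of x] kind(1)[of y] kind(2)[OF xy(1)] kind(2)[OF xy(2)]
      by (cases "x \<in> T"; cases "y \<in> T") simp_all
    moreover have "below N x x"
      using layeredD(2)[OF N(1) xy(1) xy(1)] by simp
    ultimately show ?thesis
      using 2(1) by (auto simp: dcut xy)
  qed
qed

text \<open>The functions agree on the intersection and are simply united; only the preorder needs a
  construction. New points of \<open>B\<close> and of \<open>C\<close> must never become equivalent,
  since a class has to remain a single orbit.\<close>

lemma layered_amalgam:
  fixes B C :: "'a model"
  assumes B: "is_model layered_sig B" "layered B" and C: "is_model layered_sig C" "layered C"
    and s: "\<And>x. x \<in> univ B \<inter> univ C \<Longrightarrow> shift B x = shift C x"
    and p: "\<And>x. x \<in> univ B \<inter> univ C \<Longrightarrow> proj B x = proj C x"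
    and r: "\<And>x y. x \<in> univ B \<inter> univ C \<Longrightarrow> y \<in> univ B \<inter> univ C \<Longrightarrow> below B x y \<longleftrightarrow> below C x y"
  obtains D where "univ D = univ B \<union> univ C" "is_model layered_sig D" "layered D"
    "embedding layered_sig B D id" "embedding layered_sig C D id"
proof -
  define T where "T = univ B \<inter> univ C"
  define s' where "s' x = (if x \<in> univ B then shift B x else shift C x)" for x
  define p' where "p' x = (if x \<in> univ B then proj B x else proj C x)" for x
  \<comment> \<open>Points are ordered by their cut in the common part, then by their origin, then by the order
    there. A point of the common part comes first in its cut, so it has the least kind.\<close>
  define dcut where "dcut x = {t \<in> T. if x \<in> univ B then below B t x else below C t x}" for x
  define kind :: "'a \<Rightarrow> nat" where "kind x = (if x \<in> T then 0 else if x \<in> univ B then 1 else 2)" for x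
  define R where "R x y \<longleftrightarrow> dcut x \<subset> dcut y \<or> dcut x = dcut y \<and> (kind x < kind y \<or> kind x = kind y \<and>
      (if x \<in> univ B then below B x y else below C x y))" for x y
  define D where "D = layered_model (univ B \<union> univ C) s' p' R"
  have clB: "shift B x \<in> univ B" "proj B x \<in> univ B" if "x \<in> univ B" for x
    using B that by (auto simp: is_model_layered_sig)
  have clC: "shift C x \<in> univ C" "proj C x \<in> univ C" if "x \<in> univ C" for x
    using C that by (auto simp: is_model_layered_sig)
  have sT: "shift B x \<in> T" "shift C x \<in> T" if "x \<in> T" for x
    using that s[of x] clB[of x] clC[of x] by (auto simp: T_def)
  have s'C: "s' x = shift C x" and p'C: "p' x = proj C x" if "x \<in> univ C" for x
    using that s p by (auto simp: s'_def p'_def)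
  have cutB: "dcut x = {t \<in> T. below B t x}" if "x \<in> univ B" for x
    using that by (simp add: dcut_def)
  have cutC: "dcut x = {t \<in> T. below C t x}" if "x \<in> univ C" for x
    using that r by (auto simp: dcut_def T_def)
  have TBC: "T \<subseteq> univ B" "T \<subseteq> univ C"
    by (auto simp: T_def)
  have kinds: "x \<in> T \<Longrightarrow> kind x = 0" "x \<in> univ B \<Longrightarrow> x \<notin> T \<Longrightarrow> kind x = 1"
    "x \<in> univ C \<Longrightarrow> x \<notin> T \<Longrightarrow> kind x = 2" for x
    by (auto simp: kind_def T_def)
  have RB: "R x y \<longleftrightarrow> below B x y" if "x \<in> univ B" "y \<in> univ B" for x y
    using below_iff_cut[where kind = kind, OF B(2,1) TBC(1) sT(1) cutB kinds(1,2) _ that] that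
    by (simp add: R_def)
  have RC: "R x y \<longleftrightarrow> below C x y" if "x \<in> univ C" "y \<in> univ C" for x y
  proof -
    \<comment> \<open>The definition of \<open>R\<close> gives preference to \<open>B\<close>. For
      points of \<open>C\<close> of equal kind this takes effect only if both are in the common
      part, where the two preorders agree.\<close>
    have "below C x y = (if x \<in> univ B then below B x y else below C x y)" if "kind x = kind y"
      using that \<open>x \<in> univ C\<close> \<open>y \<in> univ C\<close> r by (auto simp: kind_def T_def split: if_splits)
    then show ?thesis
      using below_iff_cut[where kind = kind, OF C(2,1) TBC(2) sT(2) cutC kinds(1,3) _ that]
      unfolding R_def by auto
  qed
  \<comment> \<open>Cuts are initial segments of the total preorder on the common part, which makes
    them comparable by inclusion.\<close>
  have down: "t' \<in> dcut x" if "t \<in> dcut x" "t' \<in> T" "below B t' t" "x \<in> univ B \<union> univ C" for t t' x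
    using that r[of t' t] layeredD(3)[OF B(2), of t' t x] layeredD(3)[OF C(2), of t' t x]
    by (cases "x \<in> univ B") (auto simp: dcut_def T_def)
  have cuts: "dcut x \<subseteq> dcut y \<or> dcut y \<subseteq> dcut x" if "x \<in> univ B \<union> univ C" "y \<in> univ B \<union> univ C" for x y
  proof (rule ccontr)
    assume "\<not> ?thesis"
    then obtain t t' where t: "t \<in> dcut x" "t \<notin> dcut y" "t' \<in> dcut y" "t' \<notin> dcut x" by blast
    then have "t \<in> T" "t' \<in> T" by (auto simp: dcut_def)
    moreover from this have "below B t t' \<or> below B t' t"
      using layeredD(2)[OF B(2)] by (auto simp: T_def)
    ultimately show False using t down that by blast
  qed
  have kindB: "y \<in> univ B \<longleftrightarrow> x \<in> univ B" if "kind x = kind y" "x \<in> univ B \<union> univ C" "y \<in> univ B \<union> univ C" for x y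
    using that by (auto simp: kind_def T_def split: if_splits)
  have sB: "(s' ^^ n) x = (shift B ^^ n) x" if "x \<in> univ B" for x n
    using funpow_shift_closed[OF B(1) that] by (induction n) (auto simp: s'_def)
  have sC: "(s' ^^ n) x = (shift C ^^ n) x" if "x \<in> univ C" for x n
    using funpow_shift_closed[OF C(1) that] by (induction n) (auto simp: s'C)
  have "layered D"
    unfolding layered_def
  proof (intro conjI ballI impI)
    fix x assume "x \<in> univ D"
    then show "proj D (shift D x) = shift D (proj D x)"
      using clB clC layeredD(1)[OF B(2)] layeredD(1)[OF C(2)] s'C p'C
      by (cases "x \<in> univ B") (auto simp: D_def s'_def p'_def)
  next
    fix x y assume xy: "x \<in> univ D" "y \<in> univ D"
    have "R x y \<or> R y x"
    proof (cases "dcut x = dcut y \<and> kind x = kind y")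
      case True
      then show ?thesis
        using kindB[of x y] xy layeredD(2)[OF B(2), of x y] layeredD(2)[OF C(2), of x y]
        by (cases "x \<in> univ B") (simp_all add: D_def R_def)
    next
      case False
      moreover have "x \<in> univ B \<union> univ C" "y \<in> univ B \<union> univ C"
        using xy by (simp_all add: D_def)
      then have "dcut x \<subset> dcut y \<or> dcut y \<subset> dcut x \<or> dcut x = dcut y"
        using cuts[of x y] by (metis psubsetI)
      ultimately show ?thesis
        unfolding R_def by (metis nat_neq_iff)
    qed
    then show "below D x y \<or> below D y x"
      by (simp add: D_def)
  next
    fix x y z assume xyz: "x \<in> univ D" "y \<in> univ D" "z \<in> univ D" "below D x y \<and> below D y z"
    then have U: "x \<in> univ B \<union> univ C" "y \<in> univ B \<union> univ C" "z \<in> univ B \<union> univ C"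
      and R: "R x y" "R y z"
      by (auto simp: D_def)
    have "R x z"
    proof (cases "dcut x = dcut y \<and> dcut y = dcut z \<and> kind x = kind y \<and> kind y = kind z")
      case True
      have "y \<in> univ B \<longleftrightarrow> x \<in> univ B" "z \<in> univ B \<longleftrightarrow> x \<in> univ B"
        using kindB[of x y] kindB[of x z] True U by metis+
      moreover have "if x \<in> univ B then below B x y else below C x y"
          "if y \<in> univ B then below B y z else below C y z"
        using R True unfolding R_def by (metis less_irrefl)+
      ultimately have "if x \<in> univ B then below B x z else below C x z"
        using U layeredD(3)[OF B(2), of x y z] layeredD(3)[OF C(2), of x y z]
        by (cases "x \<in> univ B") simp_all
      then show ?thesis using True unfolding R_def by metis
    next
      case False
      have sub: "dcut x \<subset> dcut y \<or> dcut x = dcut y \<and> kind x \<le> kind y"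
        "dcut y \<subset> dcut z \<or> dcut y = dcut z \<and> kind y \<le> kind z"
        using R unfolding R_def by (metis less_imp_le order_refl)+
      then have "dcut x \<subset> dcut z \<or> dcut x = dcut z \<and> kind x < kind z"
        using False by (elim disjE conjE) (auto intro: psubset_trans)
      then show ?thesis unfolding R_def by metis
    qed
    then show "below D x z" by (simp add: D_def)
  next
    fix x y assume xy: "x \<in> univ D" "y \<in> univ D"
    have "R x y \<and> R y x \<longleftrightarrow> (\<exists>n. (s' ^^ n) x = y)"
    proof
      assume R: "R x y \<and> R y x"
      then have "kind x = kind y" by (auto simp: R_def)
      then have "x \<in> univ B \<and> y \<in> univ B \<or> x \<in> univ C \<and> y \<in> univ C"
        using kindB[of x y] xy by (auto simp: D_def)
      then show "\<exists>n. (s' ^^ n) x = y"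
        using R RB RC sB sC layeredD(4)[OF B(2), of x y] layeredD(4)[OF C(2), of x y] by auto
    next
      assume "\<exists>n. (s' ^^ n) x = y"
      then obtain n where n: "(s' ^^ n) x = y" by blast
      show "R x y \<and> R y x"
      proof (cases "x \<in> univ B")
        case True
        then have "(shift B ^^ n) x = y" "y \<in> univ B"
          using n sB funpow_shift_closed[OF B(1)] by auto
        then show ?thesis
          using True RB layeredD(4)[OF B(2), of x y] by blast
      next
        case False
        then have x: "x \<in> univ C" using xy by (simp add: D_def)
        then have "(shift C ^^ n) x = y" "y \<in> univ C"
          using n sC funpow_shift_closed[OF C(1)] by auto
        then show ?thesis
          using x RC layeredD(4)[OF C(2), of x y] by blast
      qed
    qed
    then show "(below D x y \<and> below D y x) = (\<exists>n. (shift D ^^ n) x = y)" by (simp add: D_def)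
  qed
  moreover have "is_model layered_sig D"
    using B C clB clC by (auto simp: is_model_layered_sig D_def s'_def p'_def)
  moreover have "embedding layered_sig B D id"
    using RB by (auto simp: embedding_layered_sig D_def s'_def p'_def)
  moreover have "embedding layered_sig C D id"
    using RC s'C p'C by (auto simp: embedding_layered_sig D_def)
  ultimately show thesis
    by (intro that[of D]) (simp_all add: D_def)
qed

text \<open>If \<open>x\<close> is below \<open>g x\<close>, iterating \<open>g\<close> gives an
  ascending chain from \<open>x\<close> through \<open>g x\<close> back to \<open>x\<close>, so
  \<open>g x\<close> is below \<open>x\<close> as well; dually for a descent. Only the return of
  \<open>x\<close> is required, so the lemma applies to the infinite limit too.\<close>

lemma finite_order_preserves_layers:
  assumes M: "layered M" "is_model layered_sig M" and g: "embedding layered_sig M M g"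
    and x: "x \<in> univ M" and k: "k > 0" "(g ^^ k) x = x"
  obtains r where "g x = (shift M ^^ r) x"
proof -
  have U: "(g ^^ i) x \<in> univ M" for i
    using g x by (induction i) (auto simp: embedding_def)
  have step: "below M (g y) (g z) \<longleftrightarrow> below M y z" if "y \<in> univ M" "z \<in> univ M" for y z
    using g that by (simp add: embedding_layered_sig)
  have gx: "g x \<in> univ M" using U[of 1] by simp
  have refl: "below M y y" if "y \<in> univ M" for y
    using layeredD(2)[OF M(1) that that] by simp
  have up: "below M x (g x) \<Longrightarrow> below M ((g ^^ i) x) ((g ^^ Suc i) x)" for i
  proof (induction i)
    case (Suc i)
    then show ?case using step[OF U U, of i "Suc i"] by simp
  qed simp
  have down: "below M (g x) x \<Longrightarrow> below M ((g ^^ Suc i) x) ((g ^^ i) x)" for i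
  proof (induction i)
    case (Suc i)
    then show ?case using step[OF U U, of "Suc i" i] by simp
  qed simp
  have up': "below M (g x) ((g ^^ Suc i) x)" if "below M x (g x)" for i
  proof (induction i)
    case 0
    then show ?case using refl gx by simp
  next
    case (Suc i)
    then show ?case using layeredD(3)[OF M(1) gx U U] up[OF that] by blast
  qed
  have down': "below M ((g ^^ Suc i) x) (g x)" if "below M (g x) x" for i
  proof (induction i)
    case 0
    then show ?case using refl gx by simp
  next
    case (Suc i)
    then show ?case using layeredD(3)[OF M(1) U U gx] down[OF that] by blast
  qed
  \<comment> \<open>The chains are indexed from \<open>g x\<close> on, so the return after
    \<open>k\<close> steps is their entry at \<open>k - 1\<close>.\<close>
  have "(g ^^ Suc (k - 1)) x = x" using k by simp
  then have "below M x (g x) \<and> below M (g x) x"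
    using layeredD(2)[OF M(1) x gx] up'[of "k - 1"] down'[of "k - 1"] by metis
  then show thesis
    using layeredD(4)[OF M(1) x gx] that by metis
qed

text \<open>The exponent of an automorphism depends on the orbit. Both automorphisms commute with
  \<open>shift\<close>, however, so on the orbit of \<open>x\<close> either composite is
  \<open>shift\<close> iterated as often as the two exponents together.\<close>

lemma comm_group_Aut_layered:
  assumes M: "layered M" "is_model layered_sig M" "finite (univ M)"
  shows "comm_group (Aut layered_sig M)"
proof (rule group.group_comm_groupI[OF group_Aut[OF M(2)]])
  obtain k where k: "k > 0" "\<And>g x. g \<in> automorphisms layered_sig M \<Longrightarrow> x \<in> univ M \<Longrightarrow> (g ^^ k) x = x"
    using finite_Aut_exponent[OF M(2,3)] by blast
  fix g h assume "g \<in> carrier (Aut layered_sig M)" "h \<in> carrier (Aut layered_sig M)"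
  then have gh: "g \<in> automorphisms layered_sig M" "h \<in> automorphisms layered_sig M"
    by (simp_all add: Aut_simps)
  then have emb: "embedding layered_sig M M g" "embedding layered_sig M M h"
    by (simp_all add: automorphisms_iff isomorphism_def)
  have "g (h x) = h (g x)" if x: "x \<in> univ M" for x
  proof -
    obtain i where i: "g x = (shift M ^^ i) x"
      using finite_order_preserves_layers[OF M(1,2) emb(1) x k(1) k(2)[OF gh(1) x]] .
    obtain j where j: "h x = (shift M ^^ j) x"
      using finite_order_preserves_layers[OF M(1,2) emb(2) x k(1) k(2)[OF gh(2) x]] .
    have "g (h x) = (shift M ^^ (j + i)) x"
      using embedding_funpow_shift[OF emb(1) M(2) x] i j by (simp add: funpow_add)
    moreover have "h (g x) = (shift M ^^ (i + j)) x"
      using embedding_funpow_shift[OF emb(2) M(2) x] i j by (simp add: funpow_add)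
    ultimately show ?thesis by (simp add: add.commute)
  qed
  then show "g \<otimes>\<^bsub>Aut layered_sig M\<^esub> h = h \<otimes>\<^bsub>Aut layered_sig M\<^esub> g"
    using gh by (auto simp: Aut_simps compose_def intro!: restrict_ext)
qed

subsection \<open>The Fraisse class of finite layered models\<close>

definition layered_class :: "nat model set" where
  "layered_class = {M. is_model layered_sig M \<and> finite (univ M) \<and> layered M}"

lemma layered_class_isomorphic:
  assumes A: "A \<in> layered_class" and h: "isomorphism layered_sig A B h" and B: "is_model layered_sig B"
  shows "B \<in> layered_class"
proof -
  have A': "is_model layered_sig A" "finite (univ A)" "layered A"
    using A by (simp_all add: layered_class_def)
  have "embedding layered_sig B A (inv_into (univ A) h)"
    using isomorphism_inv_into[OF h A'(1)] by (simp add: isomorphism_def)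
  then have "layered B"
    using layered_embedding B A'(3) by blast
  moreover have "h ` univ A = univ B"
    using h by (simp add: isomorphism_def)
  then have "finite (univ B)"
    using A'(2) by (metis finite_imageI)
  ultimately show ?thesis
    using B by (simp add: layered_class_def)
qed

text \<open>Since models are nonempty, the empty common part needed for joint embedding is not a model; hence
  the set \<open>U\<close>.\<close>

lemma layered_class_amalgam:
  assumes B: "B \<in> layered_class" and C: "C \<in> layered_class"
    and A: "\<And>x. x \<in> U \<Longrightarrow> shift A x \<in> U \<and> proj A x \<in> U"
    and f: "embedding layered_sig (A\<lparr>univ := U\<rparr>) B f" and g: "embedding layered_sig (A\<lparr>univ := U\<rparr>) C g"
    and fin: "finite U"
  obtains D f' g' where "D \<in> layered_class" "embedding layered_sig B D f'" "embedding layered_sig C D g'"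
    "\<And>x. x \<in> U \<Longrightarrow> f' (f x) = g' (g x)"
proof -
  have B': "is_model layered_sig B" "finite (univ B)" "layered B"
    and C': "is_model layered_sig C" "finite (univ C)" "layered C"
    using B C by (simp_all add: layered_class_def)
  have injg: "inj_on g U" and injf: "inj_on f U" and gU: "g ` U \<subseteq> univ C" and fU: "f ` U \<subseteq> univ B"
    using f g by (simp_all add: embedding_def)
  have f': "f (shift A x) = shift B (f x)" "f (proj A x) = proj B (f x)"
    and g': "g (shift A x) = shift C (g x)" "g (proj A x) = proj C (g x)"
    if "x \<in> U" for x
    using f g that by (simp_all add: embedding_layered_sig)
  have fg: "below B (f x) (f y) \<longleftrightarrow> below C (g x) (g y)" if "x \<in> U" "y \<in> U" for x y
    using f g that by (simp add: embedding_layered_sig)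
  \<comment> \<open>\<open>\<phi>\<close> identifies the copy of \<open>U\<close> in
    \<open>C\<close> with the copy in \<open>B\<close>. Extending it by values outside
    \<open>B\<close> makes the renamed \<open>C\<close> meet \<open>B\<close> in the copy of
    \<open>U\<close> and nowhere else, so the two models can be united.\<close>
  define \<phi> where "\<phi> = f \<circ> inv_into U g"
  have \<phi>: "\<phi> (g x) = f x" if "x \<in> U" for x
    using that injg by (simp add: \<phi>_def)
  have "inj_on \<phi> (g ` U)"
    unfolding \<phi>_def by (intro comp_inj_on inj_on_inv_into) (use injf injg in auto)
  then obtain \<sigma> where \<sigma>: "inj \<sigma>" "\<And>y. y \<in> g ` U \<Longrightarrow> \<sigma> y = \<phi> y" "\<And>y. y \<notin> g ` U \<Longrightarrow> \<sigma> y \<notin> univ B"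
    using inj_extension_avoiding[of \<phi> "g ` U" "univ B"] fin B'(2) by (metis finite_imageI)
  have \<sigma>g: "\<sigma> (g x) = f x" if "x \<in> U" for x
    using \<sigma>(2) \<phi> that by simp
  let ?C = "map_model \<sigma> C"
  have inj: "inj_on \<sigma> (univ C)"
    using \<sigma>(1) by (rule inj_on_subset) simp
  have mC: "is_model layered_sig ?C"
    using inj C'(1) by (rule is_model_map_model)
  have iso: "isomorphism layered_sig C ?C \<sigma>"
    using inj by (rule isomorphism_map_model)
  have lC: "?C \<in> layered_class"
    using layered_class_isomorphic[OF C iso mC] .
  have \<sigma>C: "embedding layered_sig C ?C \<sigma>" "\<sigma> ` univ C = univ ?C"
    using iso by (simp_all add: isomorphism_def)
  have \<sigma>': "shift ?C (\<sigma> y) = \<sigma> (shift C y)" "proj ?C (\<sigma> y) = \<sigma> (proj C y)" if "y \<in> univ C" for y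
    using \<sigma>C that by (simp_all add: embedding_layered_sig)
  have \<sigma>below: "below ?C (\<sigma> y) (\<sigma> z) \<longleftrightarrow> below C y z" if "y \<in> univ C" "z \<in> univ C" for y z
    using \<sigma>C that by (simp add: embedding_layered_sig)
  have common: "\<exists>x\<in>U. z = f x \<and> z = \<sigma> (g x)" if "z \<in> univ B \<inter> univ ?C" for z
  proof -
    have "z \<in> \<sigma> ` univ C"
      using that \<sigma>C(2) by simp
    then obtain y where y: "z = \<sigma> y"
      by (rule imageE)
    then have "y \<in> g ` U"
      using that \<sigma>(3)[of y] by (metis IntD1)
    then obtain x where "x \<in> U" "y = g x"
      by (rule imageE)
    then show ?thesis using y \<sigma>g by (intro bexI[of _ x]) simp_all
  qed
  obtain D where D: "univ D = univ B \<union> univ ?C" "is_model layered_sig D" "layered D"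
    "embedding layered_sig B D id" "embedding layered_sig ?C D id"
  proof (rule layered_amalgam[of B ?C])
    fix z assume "z \<in> univ B \<inter> univ ?C"
    then obtain x where x: "x \<in> U" "z = f x" "z = \<sigma> (g x)"
      using common[of z] by metis
    have gx: "g x \<in> univ C" using gU x(1) by (metis image_subset_iff)
    show "shift B z = shift ?C z"
      using f'(1)[OF x(1)] g'(1)[OF x(1)] \<sigma>'(1)[OF gx] \<sigma>g A x by metis
    show "proj B z = proj ?C z"
      using f'(2)[OF x(1)] g'(2)[OF x(1)] \<sigma>'(2)[OF gx] \<sigma>g A x by metis
    fix z' assume "z' \<in> univ B \<inter> univ ?C"
    then obtain x' where x': "x' \<in> U" "z' = f x'" "z' = \<sigma> (g x')"
      using common[of z'] by metis
    have "g x' \<in> univ C" using gU x'(1) by (metis image_subset_iff)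
    then show "below B z z' \<longleftrightarrow> below ?C z z'"
      using fg[OF x(1) x'(1)] \<sigma>below[OF gx] x(2,3) x'(2,3) by metis
  qed (use B' mC lC in \<open>simp_all add: layered_class_def\<close>)
  have "D \<in> layered_class"
    using D lC B' by (simp add: layered_class_def)
  moreover have "embedding layered_sig C D (id \<circ> \<sigma>)"
    using \<sigma>C(1) D(5) by (rule embedding_comp)
  ultimately show thesis
    using that[OF _ D(4)] \<sigma>g by simp
qed

text \<open>Up to its irrelevant values, a finite model is coded by finite lists: its universe,
  tables of both functions up to a bound, and the pairs in the preorder. There are countably many
  such codes.\<close>

lemma countable_iso_types_layered_class: "countably_many_iso_types layered_sig layered_class"
proof -
  define mk :: "nat list \<times> nat list \<times> nat list \<times> (nat \<times> nat) list \<Rightarrow> nat model" where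
    "mk = (\<lambda>(u, s, p, r). layered_model (set u) (nth s) (nth p) (\<lambda>x y. (x, y) \<in> set r))"
  have "\<exists>B\<in>range mk \<inter> layered_class. isomorphic layered_sig A B" if A: "A \<in> layered_class" for A
  proof -
    have fin: "finite (univ A)" and mA: "is_model layered_sig A"
      using A by (simp_all add: layered_class_def)
    obtain u where u: "set u = univ A" using fin finite_list by blast
    obtain m where m: "univ A \<subseteq> {..<m}" using fin finite_nat_iff_bounded by blast
    have "finite {(x, y). x \<in> univ A \<and> y \<in> univ A \<and> below A x y}"
      by (rule finite_subset[of _ "univ A \<times> univ A"]) (use fin in auto)
    then obtain r where r: "set r = {(x, y). x \<in> univ A \<and> y \<in> univ A \<and> below A x y}"
      using finite_list by blast
    let ?B = "mk (u, map (shift A) [0..<m], map (proj A) [0..<m], r)"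
    have s: "shift ?B x = shift A x" "proj ?B x = proj A x" if "x \<in> univ A" for x
      using m that by (auto simp: mk_def)
    have iso: "isomorphism layered_sig A ?B id"
      using s u r by (auto simp: isomorphism_def embedding_layered_sig mk_def)
    moreover have "is_model layered_sig ?B"
      using s u mA by (auto simp: is_model_layered_sig mk_def)
    ultimately have "?B \<in> layered_class"
      using layered_class_isomorphic[OF A] by blast
    then show ?thesis
      using iso by (auto simp: isomorphic_def)
  qed
  then show ?thesis
    unfolding countably_many_iso_types_def
    by (intro exI[of _ "range mk \<inter> layered_class"]) auto
qed

lemma fraisse_class_layered: "fraisse_class layered_sig layered_class"
  unfolding fraisse_class_def
proof (intro conjI ballI)
  fix A assume "A \<in> layered_class"
  then show "is_model layered_sig A" "finitely_generated layered_sig A"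
    by (simp_all add: layered_class_def finitely_generated_finite)
next
  show "iso_closed layered_sig layered_class"
    using layered_class_isomorphic by (auto simp: iso_closed_def isomorphic_def)
  show "hereditary layered_sig layered_class"
    unfolding hereditary_def
  proof (intro ballI allI impI)
    fix B A assume "B \<in> layered_class" and A: "substructure layered_sig A B \<and> finitely_generated layered_sig A"
    then have "finite (univ B)" "layered B" by (simp_all add: layered_class_def)
    moreover have "is_model layered_sig A" "embedding layered_sig A B id"
      using A by (simp_all add: substructure_iff_embedding)
    moreover have "univ A \<subseteq> univ B"
      using A by (simp add: substructure_def)
    ultimately show "A \<in> layered_class"
      using layered_embedding by (auto simp: layered_class_def intro: finite_subset)
  qed
  show "joint_embedding layered_sig layered_class"
    unfolding joint_embedding_def
  proof (intro ballI)
    fix A B assume AB: "A \<in> layered_class" "B \<in> layered_class"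
    have empty: "embedding layered_sig (A\<lparr>univ := {}\<rparr>) C id" for C :: "nat model"
      by (simp add: embedding_layered_sig)
    then obtain D f' g' where "D \<in> layered_class" "embedding layered_sig A D f'" "embedding layered_sig B D g'"
      using layered_class_amalgam[OF AB _ empty empty] by (metis empty_iff finite.emptyI)
    then show "\<exists>C\<in>layered_class. embeddable layered_sig A C \<and> embeddable layered_sig B C"
      by (auto simp: embeddable_def)
  qed
  show "countably_many_iso_types layered_sig layered_class"
    by (rule countable_iso_types_layered_class)
  show "amalgamation layered_sig layered_class"
    unfolding amalgamation_def
  proof (intro ballI allI impI)
    fix A B C f g
    assume A: "A \<in> layered_class" and BC: "B \<in> layered_class" "C \<in> layered_class"
      and fg: "embedding layered_sig A B f \<and> embedding layered_sig A C g"
    have "finite (univ A)" "\<And>x. x \<in> univ A \<Longrightarrow> shift A x \<in> univ A \<and> proj A x \<in> univ A"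
      using A by (simp_all add: layered_class_def is_model_layered_sig)
    moreover have "embedding layered_sig (A\<lparr>univ := univ A\<rparr>) B f" "embedding layered_sig (A\<lparr>univ := univ A\<rparr>) C g"
      using fg by simp_all
    ultimately obtain D f' g' where "D \<in> layered_class" "embedding layered_sig B D f'"
      "embedding layered_sig C D g'" "\<And>x. x \<in> univ A \<Longrightarrow> f' (f x) = g' (g x)"
      using layered_class_amalgam[OF BC, of "univ A" A f g] by blast
    then show "\<exists>D\<in>layered_class. \<exists>f' g'. embedding layered_sig B D f' \<and> embedding layered_sig C D g' \<and>
        (\<forall>x\<in>univ A. f' (f x) = g' (g x))"
      by blast
  qed
qed

subsection \<open>Torsion-freeness of the limit\<close>

text \<open>A new cycle of length \<open>N\<close> is put on top of \<open>A\<close> and wound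
  around the orbit of \<open>x\<close>. Winding is compatible with the shift as soon as
  \<open>N\<close> is some period of \<open>x\<close>, not necessarily the least one.\<close>

lemma cyclic_cover:
  assumes A: "A \<in> layered_class" and x: "x \<in> univ A" and N: "N > 0" "(shift A ^^ N) x = x"
  obtains B c where "B \<in> layered_class" "substructure layered_sig A B" "c \<in> univ B" "proj B c = x"
    "\<And>i. (shift B ^^ i) c = c \<longleftrightarrow> N dvd i"
proof -
  have A': "is_model layered_sig A" "finite (univ A)" "layered A"
    using A by (simp_all add: layered_class_def)
  obtain m where m: "univ A \<subseteq> {..<m}"
    using A'(2) finite_nat_iff_bounded by blast
  \<comment> \<open>The new points are the numbers from \<open>m\<close> on, and
    \<open>u - m\<close> is the position of \<open>u\<close> on the new cycle; \<open>m\<close>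
    itself lies over \<open>x\<close>.\<close>
  define s where "s u = (if u < m then shift A u else m + (u - m + 1) mod N)" for u
  define p where "p u = (if u < m then proj A u else (shift A ^^ (u - m)) x)" for u
  define R where "R u v \<longleftrightarrow> m \<le> v \<or> (u < m \<and> below A u v)" for u v
  define B where "B = layered_model (univ A \<union> {m..<m + N}) s p R"
  have less: "u < m" if "u \<in> univ A" for u using m that by auto
  then have less': "\<not> m \<le> u" if "u \<in> univ A" for u using that by (simp add: not_le)
  have clA: "shift A u \<in> univ A" "proj A u \<in> univ A" if "u \<in> univ A" for u
    using A'(1) that by (auto simp: is_model_layered_sig)
  have orbit: "(shift A ^^ i) x \<in> univ A" for i
    using funpow_shift_closed[OF A'(1) x] .
  have sA: "(s ^^ i) u = (shift A ^^ i) u" if "u \<in> univ A" for u i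
    using funpow_shift_closed[OF A'(1) that] less by (induction i) (simp_all add: s_def)
  have sN: "(s ^^ i) (m + j) = m + (j + i) mod N" if "j < N" for i j
    using that by (induction i) (simp_all add: s_def mod_Suc_eq)
  have "layered B"
    unfolding layered_def
  proof (intro conjI ballI impI)
    fix u assume u: "u \<in> univ B"
    show "proj B (shift B u) = shift B (proj B u)"
    proof (cases "u \<in> univ A")
      case True
      then show ?thesis
        using less clA layeredD(1)[OF A'(3)] by (simp add: B_def s_def p_def)
    next
      case False
      then have u: "m \<le> u" "u < m + N" using u by (auto simp: B_def)
      \<comment> \<open>Where the cycle closes up, commutation of \<open>p\<close> with
        \<open>s\<close> rests on \<open>N\<close> being a period of \<open>x\<close>.\<close>
      have "(shift A ^^ ((u - m + 1) mod N)) x = (shift A ^^ (u - m + 1)) x"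
        using N(2) by (rule funpow_mod_eq)
      then show ?thesis
        using u less[OF orbit] by (simp add: B_def s_def p_def)
    qed
  next
    fix u v assume "u \<in> univ B" "v \<in> univ B"
    then show "below B u v \<or> below B v u"
      using less layeredD(2)[OF A'(3), of u v] by (auto simp: B_def R_def)
  next
    fix u v w assume "u \<in> univ B" "v \<in> univ B" "w \<in> univ B" "below B u v \<and> below B v w"
    then show "below B u w"
      using less layeredD(3)[OF A'(3), of u v w] by (auto simp: B_def R_def)
  next
    fix u v assume uv: "u \<in> univ B" "v \<in> univ B"
    show "(below B u v \<and> below B v u) \<longleftrightarrow> (\<exists>n. (shift B ^^ n) u = v)"
    proof (cases "u \<in> univ A")
      case u: True
      show ?thesis
      proof (cases "v \<in> univ A")
        case True
        then show ?thesis
          using less[OF u] less[OF True] layeredD(4)[OF A'(3) u True] sA[OF u]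
          by (simp add: B_def R_def)
      next
        case False
        then have "m \<le> v" using uv by (auto simp: B_def)
        then have "\<not> R v u" using less[OF u] by (simp add: R_def)
        moreover have "(s ^^ n) u \<noteq> v" for n
          using False sA[OF u] funpow_shift_closed[OF A'(1) u] by metis
        ultimately show ?thesis by (simp add: B_def)
      qed
    next
      case False
      then obtain j where j: "u = m + j" "j < N"
        using uv(1) by (auto simp: B_def le_iff_add)
      show ?thesis
      proof (cases "v \<in> univ A")
        case True
        then have "\<not> R u v" using less[OF True] j by (simp add: R_def)
        moreover have "(s ^^ n) u \<noteq> v" for n
          using less[OF True] sN[OF j(2)] j(1) by auto
        ultimately show ?thesis by (simp add: B_def)
      next
        case False
        then obtain l where l: "v = m + l" "l < N"
          using uv(2) by (auto simp: B_def le_iff_add)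
        have "(j + (N - j + l)) mod N = l"
          using j(2) l(2) by simp
        then have "(s ^^ (N - j + l)) u = v"
          using sN[OF j(2), of "N - j + l"] j(1) l(1) by simp
        moreover have "R u v \<and> R v u"
          using j l by (simp add: R_def)
        ultimately show ?thesis by (auto simp: B_def)
      qed
    qed
  qed
  moreover have "is_model layered_sig B"
    using x N(1) clA orbit less by (auto simp: is_model_layered_sig B_def s_def p_def)
  ultimately have "B \<in> layered_class"
    using A'(2) by (simp add: layered_class_def B_def)
  moreover have "substructure layered_sig A B"
    using A'(1) less less' by (auto simp: substructure_iff_embedding embedding_layered_sig B_def s_def p_def R_def)
  moreover have "m \<in> univ B" "proj B m = x"
    using N(1) by (simp_all add: B_def p_def)
  moreover have "(shift B ^^ i) m = m \<longleftrightarrow> N dvd i" for i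
    using sN[OF N(1), of i] by (simp add: B_def dvd_eq_mod_eq_0)
  ultimately show thesis
    by (rule that)
qed

section \<open>The limit itself is layered\<close>

lemma fraisse_limit_layered_local:
  fixes F :: "nat model"
  assumes F: "fraisse_limit layered_sig layered_class F" and X: "finite X" "X \<noteq> {}" "X \<subseteq> univ F"
  obtains A where "A \<in> layered_class" "substructure layered_sig A F" "finitely_generated layered_sig A"
    "X \<subseteq> univ A" "shift A = shift F" "proj A = proj F" "below A = below F"
proof -
  have F': "is_model layered_sig F" "age layered_sig F = layered_class"
    using F by (simp_all add: fraisse_limit_def)
  let ?A = "F\<lparr>univ := generated layered_sig F X\<rparr>"
  note * = generated_substructure[OF F'(1) X]
  have "?A \<in> age layered_sig F"
    using * by (auto simp: age_def embeddable_def substructure_iff_embedding)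
  with F'(2) * show thesis
    by (intro that[of ?A]) (auto intro: generated.base)
qed

text \<open>Each clause concerns at most three points and their orbits, all contained in one
  generated substructure, which belongs to the age.\<close>

lemma fraisse_limit_layered:
  fixes F :: "nat model"
  assumes F: "fraisse_limit layered_sig layered_class F"
  shows "layered F"
  unfolding layered_def
proof (intro conjI ballI impI)
  fix x assume "x \<in> univ F"
  then obtain A where "A \<in> layered_class" "x \<in> univ A" "shift A = shift F" "proj A = proj F"
    using fraisse_limit_layered_local[OF F, of "{x}"] by auto
  then show "proj F (shift F x) = shift F (proj F x)"
    using layeredD(1)[of A x] by (simp add: layered_class_def)
next
  fix x y assume "x \<in> univ F" "y \<in> univ F"
  then obtain A where A: "A \<in> layered_class" "x \<in> univ A" "y \<in> univ A" "below A = below F" "shift A = shift F"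
    using fraisse_limit_layered_local[OF F, of "{x, y}"] by auto
  then show "below F x y \<or> below F y x" "below F x y \<and> below F y x \<longleftrightarrow> (\<exists>n. (shift F ^^ n) x = y)"
    using layeredD(2,4)[of A x y] by (simp_all add: layered_class_def)
next
  fix x y z assume "x \<in> univ F" "y \<in> univ F" "z \<in> univ F" and xyz: "below F x y \<and> below F y z"
  then obtain A where A: "A \<in> layered_class" "x \<in> univ A" "y \<in> univ A" "z \<in> univ A" "below A = below F"
    using fraisse_limit_layered_local[OF F, of "{x, y, z}"] by auto
  then show "below F x z"
    using layeredD(3)[of A x y z] xyz by (simp add: layered_class_def)
qed

lemma torsion_free_Aut_fraisse_limit:
  fixes F :: "nat model"
  assumes F: "fraisse_limit layered_sig layered_class F"
  shows "torsion_free (Aut layered_sig F)"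
  unfolding torsion_free_def
proof (intro ballI impI)
  fix g assume "g \<in> carrier (Aut layered_sig F)"
  then have g: "g \<in> automorphisms layered_sig F" by (simp add: Aut_simps)
  assume "\<exists>k::nat. k > 0 \<and> g [^]\<^bsub>Aut layered_sig F\<^esub> k = \<one>\<^bsub>Aut layered_sig F\<^esub>"
  then obtain k :: nat where k: "k > 0" "g [^]\<^bsub>Aut layered_sig F\<^esub> k = \<one>\<^bsub>Aut layered_sig F\<^esub>"
    by blast
  have mF: "is_model layered_sig F" and lF: "layered F"
    using F fraisse_limit_layered by (simp_all add: fraisse_limit_def)
  have emb: "embedding layered_sig F F g"
    using g by (simp add: automorphisms_iff isomorphism_def)
  have gk: "(g ^^ k) x = x" if "x \<in> univ F" for x
    using Aut_pow[OF mF g that, of k] k(2) that by (simp add: Aut_simps)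
  have fixed: "g x = x" if x: "x \<in> univ F" for x
  proof -
    obtain n where n: "n > 0" "(shift F ^^ n) x = x"
      using shift_periodic[OF lF mF x] .
    obtain A where A: "A \<in> layered_class" "substructure layered_sig A F" "finitely_generated layered_sig A"
      "x \<in> univ A" "shift A = shift F"
      using fraisse_limit_layered_local[OF F, of "{x}"] x by auto
    \<comment> \<open>Any multiple of \<open>n\<close> is an admissible length for the cover. The
      factor \<open>k\<close>, for which the \<open>k\<close>-th power of \<open>g\<close> is
      trivial, is the one that cancels at the end.\<close>
    have "(shift A ^^ (k * n)) x = x"
      using funpow_mod_eq[OF n(2), of "k * n"] A(5) by simp
    then obtain B c where B: "B \<in> layered_class" "substructure layered_sig A B" "c \<in> univ B" "proj B c = x"
      "\<And>i. (shift B ^^ i) c = c \<longleftrightarrow> k * n dvd i"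
      using cyclic_cover[OF A(1,4), of "k * n"] k(1) n(1) by (metis mult_pos_pos)
    have mB: "is_model layered_sig B" "finite (univ B)"
      using B(1) by (simp_all add: layered_class_def)
    \<comment> \<open>As \<open>e\<close> fixes \<open>A\<close> pointwise, the image of
      \<open>c\<close> covers \<open>x\<close> itself and not merely a copy of
      \<open>x\<close>.\<close>
    obtain e where e: "embedding layered_sig B F e" "\<And>y. y \<in> univ A \<Longrightarrow> e y = y"
      using fraisse_limit_extension[OF F A(2,3) B(1,2) mB(2)] by metis
    define d where "d = e c"
    have d: "d \<in> univ F" "proj F d = x"
      using e B(3,4) A(4) by (auto simp: d_def embedding_layered_sig)
    have period: "(shift F ^^ i) d = d \<longleftrightarrow> k * n dvd i" for i
    proof -
      have "(shift F ^^ i) d = e ((shift B ^^ i) c)"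
        using embedding_funpow_shift[OF e(1) mB(1) B(3)] by (simp add: d_def)
      moreover have "e ((shift B ^^ i) c) = e c \<longleftrightarrow> (shift B ^^ i) c = c"
        using e(1) B(3) funpow_shift_closed[OF mB(1) B(3)] by (auto simp: embedding_def inj_on_def)
      ultimately show ?thesis using B(5) by (simp add: d_def)
    qed
    obtain r where r: "g d = (shift F ^^ r) d"
      using finite_order_preserves_layers[OF lF mF emb d(1) k(1) gk[OF d(1)]] .
    \<comment> \<open>For \<open>j = k\<close> the left side is \<open>d\<close>, so the period
      \<open>k * n\<close> of \<open>d\<close> divides \<open>k * r\<close>.\<close>
    have "(g ^^ j) d = (shift F ^^ (j * r)) d" for j
    proof (induction j)
      case (Suc j)
      then have "(g ^^ Suc j) d = (shift F ^^ (j * r)) (g d)"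
        using embedding_funpow_shift[OF emb mF d(1)] by simp
      also have "\<dots> = (shift F ^^ (j * r + r)) d"
        using r by (simp add: funpow_add)
      finally show ?case by (simp add: add.commute)
    qed simp
    then have "k * n dvd k * r"
      using gk[OF d(1)] period[of "k * r"] by simp
    then have "n dvd r"
      using k(1) by simp
    then have "(shift F ^^ r) x = x"
      using funpow_mod_eq[OF n(2), of r] by (simp add: dvd_eq_mod_eq_0)
    \<comment> \<open>\<open>proj F\<close> commutes with both \<open>g\<close> and
      \<open>shift F\<close>, so the orbit of \<open>x\<close> inherits the exponent found on its
      cover.\<close>
    moreover have "g x = (shift F ^^ r) x"
      using emb d r proj_funpow_shift[OF lF mF d(1), of r] by (auto simp: embedding_layered_sig)
    ultimately show ?thesis by simp
  qed
  have "g \<in> extensional (univ F)"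
    using g by (simp add: automorphisms_iff)
  then show "g = \<one>\<^bsub>Aut layered_sig F\<^esub>"
    using fixed by (auto simp: Aut_simps extensional_def restrict_def)
qed

subsection \<open>Products of cyclic groups\<close>

text \<open>A point is coded by the index of its cycle and its position there. With
  \<open>id\<close> as projection no cycle constrains another, so the rotations are independent;
  ordering by the index makes each cycle one class.\<close>

definition cycles_model :: "nat \<Rightarrow> (nat \<Rightarrow> nat) \<Rightarrow> nat model" where
  "cycles_model k n = layered_model {x. fst (prod_decode x) < k \<and> snd (prod_decode x) < n (fst (prod_decode x))}
     (\<lambda>x. prod_encode (fst (prod_decode x), Suc (snd (prod_decode x)) mod n (fst (prod_decode x))))
     id (\<lambda>x y. fst (prod_decode x) \<le> fst (prod_decode y))"

lemma cycles_model_univ: "x \<in> univ (cycles_model k n) \<longleftrightarrow> (\<exists>i j. x = prod_encode (i, j) \<and> i < k \<and> j < n i)"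
proof -
  have "x = prod_encode (fst (prod_decode x), snd (prod_decode x))" by simp
  then show ?thesis
    by (auto simp: cycles_model_def simp del: prod.collapse)
qed

lemma cycles_model_mem [simp]: "prod_encode (i, j) \<in> univ (cycles_model k n) \<longleftrightarrow> i < k \<and> j < n i"
  by (simp add: cycles_model_univ)

lemma ball_cycles_model: "(\<forall>x\<in>univ (cycles_model k n). Q x) \<longleftrightarrow> (\<forall>i<k. \<forall>j<n i. Q (prod_encode (i, j)))"
  by (auto simp: cycles_model_univ)

lemma cycles_model_simps [simp]:
  "shift (cycles_model k n) (prod_encode (i, j)) = prod_encode (i, Suc j mod n i)"
  "proj (cycles_model k n) = id"
  "below (cycles_model k n) (prod_encode (i, j)) (prod_encode (i', j')) \<longleftrightarrow> i \<le> i'"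
  by (simp_all add: cycles_model_def)

lemma funpow_shift_cycles_model:
  assumes "j < n i"
  shows "(shift (cycles_model k n) ^^ r) (prod_encode (i, j)) = prod_encode (i, (j + r) mod n i)"
  using assms by (induction r) (simp_all add: mod_Suc_eq)

lemma layered_cycles_model:
  assumes "k > 0" "\<And>i. i < k \<Longrightarrow> n i > 0"
  shows "is_model layered_sig (cycles_model k n)" "finite (univ (cycles_model k n))" "layered (cycles_model k n)"
proof -
  let ?M = "cycles_model k n"
  have "prod_encode (0, 0) \<in> univ ?M"
    using assms by simp
  then have "univ ?M \<noteq> {}" by blast
  then show "is_model layered_sig ?M"
    using assms(2) by (simp add: is_model_layered_sig ball_cycles_model)
  have "univ ?M \<subseteq> prod_encode ` (SIGMA i:{..<k}. {..<n i})"
    by (auto simp: cycles_model_univ)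
  then show "finite (univ ?M)"
    by (rule finite_subset) simp
  show "layered ?M"
    unfolding layered_def
  proof (intro conjI ballI impI)
    fix x y assume "x \<in> univ ?M" "y \<in> univ ?M"
    then obtain i j i' j' where x: "x = prod_encode (i, j)" "j < n i" and y: "y = prod_encode (i', j')" "j' < n i'"
      by (auto simp: cycles_model_univ)
    show "below ?M x y \<or> below ?M y x"
      using x y by (simp add: linear)
    \<comment> \<open>Going from \<open>j\<close> to \<open>j'\<close> around the end of the cycle
      avoids a negative number of steps when \<open>j'\<close> is smaller.\<close>
    have "(j + (n i - j + j')) mod n i = j'" if "i = i'"
      using x y that by simp
    then have "i = i' \<longleftrightarrow> (\<exists>r. (shift ?M ^^ r) x = y)"
      using x y by (auto simp: funpow_shift_cycles_model)
    then show "(below ?M x y \<and> below ?M y x) \<longleftrightarrow> (\<exists>r. (shift ?M ^^ r) x = y)"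
      using x y by auto
  next
    fix x y z assume "x \<in> univ ?M" "y \<in> univ ?M" "z \<in> univ ?M" "below ?M x y \<and> below ?M y z"
    then show "below ?M x z"
      by (auto simp: cycles_model_univ)
  qed simp
qed

text \<open>\<open>K\<close> counts the cycles and \<open>k\<close> the factors of the product. The
  surplus cycles are fixed points without nontrivial rotation, which lets a nonempty model realise
  the empty product.\<close>

lemma Aut_cycles_model:
  assumes "k \<le> K" and K: "K > 0" and n: "\<And>i. i < K \<Longrightarrow> n i > 0"
    and triv: "\<And>i. k \<le> i \<Longrightarrow> i < K \<Longrightarrow> n i = 1"
  shows "Aut layered_sig (cycles_model K n) \<cong> product_group {..<k} (\<lambda>i. integer_mod_group (n i))"
proof -
  let ?M = "cycles_model K n" and ?P = "product_group {..<k} (\<lambda>i. integer_mod_group (n i))"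
  note M = layered_cycles_model[where n = n, OF K n]
  \<comment> \<open>From index \<open>k\<close> on, an element of the product has the unspecified
    value of an extensional function. The cycles there have length 1, so any number of steps gives
    the same map.\<close>
  define rot where "rot z = (\<lambda>x\<in>univ ?M. (shift ?M ^^ nat (z (fst (prod_decode x)))) x)" for z :: "nat \<Rightarrow> int"
  have mem: "prod_encode (i, j) \<in> univ ?M" if "i < K" "j < n i" for i j
    using that by simp
  have rot: "rot z (prod_encode (i, j)) = prod_encode (i, (j + nat (z i)) mod n i)" if "i < K" "j < n i" for z i j
    using that mem by (simp add: rot_def funpow_shift_cycles_model)
  have cong: "j = j'" if "(j + c) mod m = (j' + c) mod m" "j < m" "j' < m" for j j' c m :: nat
  proof -
    \<comment> \<open>Rotation by \<open>c\<close> is undone by adding \<open>m * c - c\<close>, a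
      natural number congruent to the negative of \<open>c\<close> modulo \<open>m\<close>.\<close>
    have "((a + c) mod m + (m * c - c)) mod m = a" if "a < m" for a
    proof -
      have "c \<le> m * c" using that by simp
      then have "a + c + (m * c - c) = a + m * c" by simp
      then show ?thesis using that by (metis mod_add_left_eq mod_less mod_mult_self2)
    qed
    then show ?thesis using that by metis
  qed
  have rot_aut: "rot z \<in> automorphisms layered_sig ?M" for z
  proof -
    have closed: "rot z ` univ ?M \<subseteq> univ ?M"
      using n by (simp add: image_subset_iff ball_cycles_model rot)
    have inj: "inj_on (rot z) (univ ?M)"
      by (rule inj_onI) (auto simp: cycles_model_univ rot dest: cong)
    have "rot z (shift ?M x) = shift ?M (rot z x)" if "x \<in> univ ?M" for x
      using that n by (auto simp: cycles_model_univ rot mod_simps)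
    moreover have "below ?M x y \<longleftrightarrow> below ?M (rot z x) (rot z y)" if "x \<in> univ ?M" "y \<in> univ ?M" for x y
      using that by (auto simp: cycles_model_univ rot)
    ultimately have "embedding layered_sig ?M ?M (rot z)"
      using closed inj by (simp add: embedding_layered_sig)
    moreover have "rot z ` univ ?M = univ ?M"
      using M(2) closed inj by (rule endo_inj_surj)
    ultimately show ?thesis
      by (simp add: automorphisms_iff isomorphism_def rot_def)
  qed
  have carrier: "z \<in> carrier ?P \<longleftrightarrow> z \<in> extensional {..<k} \<and> (\<forall>i<k. 0 \<le> z i \<and> z i < int (n i))" for z
    using n \<open>k \<le> K\<close> by (auto simp: carrier_integer_mod_group PiE_iff)
  have "rot (y \<otimes>\<^bsub>?P\<^esub> z) = rot y \<otimes>\<^bsub>Aut layered_sig ?M\<^esub> rot z"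
    if y: "y \<in> carrier ?P" and z: "z \<in> carrier ?P" for y z
  proof -
    have "rot (y \<otimes>\<^bsub>?P\<^esub> z) x = rot y (rot z x)" if xM: "x \<in> univ ?M" for x
    proof -
      obtain i j where x: "x = prod_encode (i, j)" "i < K" "j < n i"
        using xM by (auto simp: cycles_model_univ)
      show ?thesis
      proof (cases "i < k")
        case False
        then show ?thesis using x triv[of i] by (simp add: rot)
      next
        case True
        have "0 \<le> y i" "0 \<le> z i"
          using True y[unfolded carrier] z[unfolded carrier] by blast+
        then have "nat ((y \<otimes>\<^bsub>?P\<^esub> z) i) = (nat (y i) + nat (z i)) mod n i"
          using True by (simp add: product_group_def nat_mod_distrib nat_add_distrib)
        then show ?thesis
          using x n[OF x(2)] by (simp add: rot mod_simps ac_simps)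
      qed
    qed
    moreover have "rot (y \<otimes>\<^bsub>?P\<^esub> z) \<in> extensional (univ ?M)"
      by (simp add: rot_def)
    ultimately show ?thesis
      using rot_aut by (auto simp: Aut_simps compose_def extensional_def restrict_def fun_eq_iff)
  qed
  then have "rot \<in> hom ?P (Aut layered_sig ?M)"
    using rot_aut by (auto simp: hom_def Aut_simps)
  moreover have "inj_on rot (carrier ?P)"
  proof (rule inj_onI)
    fix y z assume y: "y \<in> carrier ?P" and z: "z \<in> carrier ?P" and eq: "rot y = rot z"
    have "y i = z i" if "i < k" for i
    proof -
      have yz: "0 \<le> y i" "0 \<le> z i" "nat (y i) < n i" "nat (z i) < n i"
        using that y[unfolded carrier] z[unfolded carrier] by (simp_all add: nat_less_iff)
      have "rot y (prod_encode (i, 0)) = rot z (prod_encode (i, 0))"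
        using eq by simp
      then show ?thesis
        using yz that \<open>k \<le> K\<close> by (simp add: rot)
    qed
    then show "y = z"
      using y[unfolded carrier] z[unfolded carrier] by (intro extensionalityI[of y "{..<k}" z]) simp_all
  qed
  moreover have "g \<in> rot ` carrier ?P" if g: "g \<in> automorphisms layered_sig ?M" for g
  proof -
    have emb: "embedding layered_sig ?M ?M g"
      using g by (simp add: automorphisms_iff isomorphism_def)
    \<comment> \<open>Position 0 generates its cycle under \<open>shift\<close>, so \<open>g\<close>
      is determined by the images of these points.\<close>
    have "\<exists>r. g (prod_encode (i, 0)) = prod_encode (i, r mod n i)" if i: "i < K" for i
    proof -
      have x: "prod_encode (i, 0) \<in> univ ?M"
        using mem[OF i n[OF i]] .
      obtain m where m: "m > 0" "(g ^^ m) (prod_encode (i, 0)) = prod_encode (i, 0)"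
        using finite_Aut_exponent[OF M(1,2)] g x by blast
      obtain r where "g (prod_encode (i, 0)) = (shift ?M ^^ r) (prod_encode (i, 0))"
        using finite_order_preserves_layers[OF M(3,1) emb x m] .
      then show ?thesis
        using n[OF i] by (auto simp: funpow_shift_cycles_model)
    qed
    then obtain r where r: "\<And>i. i < K \<Longrightarrow> g (prod_encode (i, 0)) = prod_encode (i, r i mod n i)"
      by metis
    define z where "z = (\<lambda>i\<in>{..<k}. int (r i mod n i))"
    have "z \<in> carrier ?P"
      unfolding carrier using n \<open>k \<le> K\<close> by (simp add: z_def)
    moreover have "g = rot z"
    proof (rule extensionalityI[of _ "univ ?M"])
      show "g \<in> extensional (univ ?M)" "rot z \<in> extensional (univ ?M)"
        using g by (simp_all add: automorphisms_iff rot_def)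
      fix x assume "x \<in> univ ?M"
      then obtain i j where x: "x = prod_encode (i, j)" "i < K" "j < n i"
        by (auto simp: cycles_model_univ)
      have "x = (shift ?M ^^ j) (prod_encode (i, 0))"
        using x n[OF x(2)] by (simp add: funpow_shift_cycles_model)
      then have "g x = (shift ?M ^^ j) (prod_encode (i, r i mod n i))"
        using embedding_funpow_shift[OF emb M(1) mem[OF x(2) n[OF x(2)]]] r[OF x(2)] by simp
      also have "\<dots> = prod_encode (i, (j + r i) mod n i)"
        using n[OF x(2)] by (simp add: funpow_shift_cycles_model mod_simps ac_simps)
      also have "\<dots> = rot z x"
        using x triv[of i] by (cases "i < k") (simp_all add: rot z_def mod_simps)
      finally show "g x = rot z x" .
    qed
    ultimately show ?thesis by blast
  qed
  then have "rot ` carrier ?P = carrier (Aut layered_sig ?M)"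
    using rot_aut by (auto simp: Aut_simps)
  ultimately have "rot \<in> iso ?P (Aut layered_sig ?M)"
    by (simp add: iso_def bij_betw_def)
  then have "?P \<cong> Aut layered_sig ?M"
    by (auto simp: is_iso_def)
  moreover have "group ?P"
    by (intro product_group) simp
  ultimately show ?thesis
    by (simp add: group.iso_sym)
qed

lemma product_group_cong:
  "(\<And>i. i \<in> I \<Longrightarrow> G i = H i) \<Longrightarrow> product_group I G = product_group I H"
  by (simp add: product_group_def cong: PiE_cong restrict_cong)

lemma layered_class_product:
  fixes k :: nat and n :: "nat \<Rightarrow> nat"
  assumes n: "\<And>i. i < k \<Longrightarrow> n i > 0"
  shows "\<exists>M\<in>layered_class. Aut layered_sig M \<cong> product_group {..<k} (\<lambda>i. integer_mod_group (n i))"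
proof -
  \<comment> \<open>The additional fixed point makes the model nonempty for \<open>k = 0\<close>.\<close>
  define n' where "n' i = (if i < k then n i else 1)" for i
  have n': "i < Suc k \<Longrightarrow> n' i > 0" "k \<le> i \<Longrightarrow> n' i = 1" for i
    using n by (simp_all add: n'_def)
  have "product_group {..<k} (\<lambda>i. integer_mod_group (n' i)) = product_group {..<k} (\<lambda>i. integer_mod_group (n i))"
    by (rule product_group_cong) (simp add: n'_def)
  then have "Aut layered_sig (cycles_model (Suc k) n') \<cong> product_group {..<k} (\<lambda>i. integer_mod_group (n i))"
    using Aut_cycles_model[of k "Suc k" n'] n' by simp
  moreover have "cycles_model (Suc k) n' \<in> layered_class"
    using layered_cycles_model[of "Suc k" n'] n'(1) by (simp add: layered_class_def)
  ultimately show ?thesis by blast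
qed

theorem theorem3:
  shows "\<exists>(L :: signature) (Z :: nat model set).
    finite_signature L \<and>
    fraisse_class L Z \<and>
    (\<forall>M\<in>Z. finite (univ M)) \<and>
    (\<forall>M\<in>Z. comm_group (Aut L M)) \<and>
    (\<forall>(k :: nat) (n :: nat \<Rightarrow> nat). (\<forall>i<k. n i > 0) \<longrightarrow>
       (\<exists>M\<in>Z. Aut L M \<cong> product_group {..<k} (\<lambda>i. integer_mod_group (n i)))) \<and>
    (\<exists>F :: nat model. fraisse_limit L Z F) \<and>
    (\<forall>F :: nat model. fraisse_limit L Z F \<longrightarrow> torsion_free (Aut L F))"
proof (intro exI[of _ layered_sig] exI[of _ layered_class] conjI)
  show "finite_signature layered_sig"
    by (simp add: finite_signature_def layered_sig_def)
  show fraisse: "fraisse_class layered_sig layered_class"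
    by (rule fraisse_class_layered)
  show fin: "\<forall>M\<in>layered_class. finite (univ M)"
    by (simp add: layered_class_def)
  show "\<forall>M\<in>layered_class. comm_group (Aut layered_sig M)"
    by (simp add: layered_class_def comm_group_Aut_layered)
  show "\<forall>(k :: nat) (n :: nat \<Rightarrow> nat). (\<forall>i<k. n i > 0) \<longrightarrow>
      (\<exists>M\<in>layered_class. Aut layered_sig M \<cong> product_group {..<k} (\<lambda>i. integer_mod_group (n i)))"
    using layered_class_product by blast
  have "layered_class \<noteq> {}"
    using layered_class_product[of 0 "\<lambda>_. 1"] by blast
  with fraisse fin show "\<exists>F :: nat model. fraisse_limit layered_sig layered_class F"
    by (rule fraisse_limit_exists)
  show "\<forall>F :: nat model. fraisse_limit layered_sig layered_class F \<longrightarrow> torsion_free (Aut layered_sig F)"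
    using torsion_free_Aut_fraisse_limit by blast
qed

end
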